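(* Assume that: (8) $a(t)$, $b(t)$ and $\frac{1}{b(t)}$ are bounded on $[t_0,+\infty)$; (9) $G_1(t)$ is real and $G_1(t)>0$ for all $t\ge t_0$, and $\lim_{t\to+\infty}\frac{G_1'(t)}{G_1^{3/2}(t)}=\alpha_1$ for some $\alpha_1$ with $|\alpha_1|<4$; (10) the functions $t\mapsto\mathcal{L}_1(t)$ and $t\mapsto\mathrm{Var}_{t_0}^{t}\frac{G_1'}{G_1^{3/2}}$ are bounded on $[t_0,+\infty)$. Then: (i) the system $\phi'=a\phi+b\psi,\ \psi'=c\phi+d\psi$ ($t\ge t_0$) is Lyapunov stable if and only if both $$\sup_{t\ge t_0}\Bigl[\int_{t_0}^{t}\operatorname{Re}S(\tau)\,d\tau+\ln|b(t)|-\tfrac12\ln G_1(t)+2\ln\Bigl(1+\Bigl|S(t)+\frac{b'(t)}{b(t)}\Bigr|\Bigr)\Bigr]<+\infty$$ and $$\sup_{t\ge t_0}\Bigl[\int_{t_0}^{t}\operatorname{Re}S(\tau)\,d\tau+\ln|b(t)|+\tfrac12\ln G_1(t)\Bigr]<+\infty;$$ (ii) the system is asymptotically stable if and only if both $$\lim_{t\to+\infty}\Bigl[\int_{t_0}^{t}\operatorname{Re}S(\tau)\,d\tau+\ln|b(t)|-\tfrac12\ln G_1(t)+2\ln\Bigl(1+\Bigl|S(t)+\frac{b'(t)}{b(t)}\Bigr|\Bigr)\Bigr]=-\infty$$ and $$\lim_{t\to+\infty}\Bigl[\int_{t_0}^{t}\operatorname{Re}S(\tau)\,d\tau+\ln|b(t)|+\tfrac12\ln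 G_1(t)\Bigr]=-\infty.$$
   Context: Let $a,b,c,d:[t_0,+\infty)\to\mathbb{C}$ be continuously differentiable with $b(t)\ne0$ and $c(t)\ne0$ for all $t\ge t_0$. Consider the linear system $\phi'=a(t)\phi+b(t)\psi$, $\psi'=c(t)\phi+d(t)\psi$, $t\ge t_0$. The system is called Lyapunov stable if all its solutions are bounded on $[t_0,+\infty)$, and asymptotically stable if all its solutions tend to $0$ as $t\to+\infty$. Put $S(t)=a(t)+d(t)$, and assume that $S+\frac{b'}{b}$ and $S+\frac{c'}{c}$ are continuously differentiable on $[t_0,+\infty)$. Define $$D_1=\frac{ab'-a'b}{b}+ad-bc,\qquad G_1=D_1+\frac12\Bigl[S+\frac{b'}{b}\Bigr]'-\frac14\Bigl[S+\frac{b'}{b}\Bigr]^2.$$ The function $G_1$ is assumed continuously differentiable on $[t_0,+\infty)$. When $G_1>0$ define $$\mathcal{L}_1(t)=\frac{1}{\sqrt[4]{G_1(t)}}\int_{t_0}^{t}\frac{|(\sqrt{G_1(\tau)})'|}{\sqrt[4]{G_1(\tau)}}\,d\tau,\qquad t\ge t_0.$$ $\mathrm{Var}_{t_0}^{t}f$ denotes the total variation of $f$ on $[t_0,t]$. *)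

theory Defs
  imports "HOL-Analysis.Analysis"
begin

text \<open>
  Functions on the half-line \<open>[t0, \<infinity>)\<close> are total functions on the reals of which only the
  values on \<open>{t0..}\<close> are used. Accordingly all derivatives are taken within \<open>{t0..}\<close>, so the
  derivative at the endpoint \<open>t0\<close> is the right derivative.
\<close>

definition hderiv :: "real \<Rightarrow> (real \<Rightarrow> 'a::real_normed_vector) \<Rightarrow> real \<Rightarrow> 'a" where
  "hderiv t0 f t = vector_derivative f (at t within {t0..})"

definition C1_from :: "real \<Rightarrow> (real \<Rightarrow> 'a::real_normed_vector) \<Rightarrow> bool" where
  "C1_from t0 f \<longleftrightarrow>
     (\<forall>t\<ge>t0. f differentiable (at t within {t0..})) \<and> continuous_on {t0..} (hderiv t0 f)"

text \<open>Extended-real valued: a continuous function may have infinite variation on a compact interval.\<close>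

definition total_var :: "real \<Rightarrow> real \<Rightarrow> (real \<Rightarrow> real) \<Rightarrow> ereal" where
  "total_var s t f =
     (SUP (n, x) \<in> {(n::nat, x::nat \<Rightarrow> real). mono_on {..n} x \<and> x 0 = s \<and> x n = t}.
        ereal (\<Sum>i<n. \<bar>f (x (Suc i)) - f (x i)\<bar>))"

definition is_solution ::
  "real \<Rightarrow> (real \<Rightarrow> complex) \<Rightarrow> (real \<Rightarrow> complex) \<Rightarrow> (real \<Rightarrow> complex) \<Rightarrow> (real \<Rightarrow> complex) \<Rightarrow>
   (real \<Rightarrow> complex) \<Rightarrow> (real \<Rightarrow> complex) \<Rightarrow> bool" where
  "is_solution t0 a b c d \<phi> \<psi> \<longleftrightarrow>
     (\<forall>t\<ge>t0. (\<phi> has_vector_derivative (a t * \<phi> t + b t * \<psi> t)) (at t within {t0..}) \<and>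
             (\<psi> has_vector_derivative (c t * \<phi> t + d t * \<psi> t)) (at t within {t0..}))"

definition lyapunov_stable ::
  "real \<Rightarrow> (real \<Rightarrow> complex) \<Rightarrow> (real \<Rightarrow> complex) \<Rightarrow> (real \<Rightarrow> complex) \<Rightarrow> (real \<Rightarrow> complex) \<Rightarrow> bool" where
  "lyapunov_stable t0 a b c d \<longleftrightarrow>
     (\<forall>\<phi> \<psi>. is_solution t0 a b c d \<phi> \<psi> \<longrightarrow> bounded (\<phi> ` {t0..}) \<and> bounded (\<psi> ` {t0..}))"

definition asymptotically_stable ::
  "real \<Rightarrow> (real \<Rightarrow> complex) \<Rightarrow> (real \<Rightarrow> complex) \<Rightarrow> (real \<Rightarrow> complex) \<Rightarrow> (real \<Rightarrow> complex) \<Rightarrow> bool" where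
  "asymptotically_stable t0 a b c d \<longleftrightarrow>
     (\<forall>\<phi> \<psi>. is_solution t0 a b c d \<phi> \<psi> \<longrightarrow> (\<phi> \<longlongrightarrow> 0) at_top \<and> (\<psi> \<longlongrightarrow> 0) at_top)"

definition S_fun :: "(real \<Rightarrow> complex) \<Rightarrow> (real \<Rightarrow> complex) \<Rightarrow> real \<Rightarrow> complex" where
  "S_fun a d t = a t + d t"

text \<open>\<open>S_plus_log t0 a d b\<close> is \<open>S + b'/b\<close>; \<open>S_plus_log t0 a d c\<close> is \<open>S + c'/c\<close>.\<close>

definition S_plus_log ::
  "real \<Rightarrow> (real \<Rightarrow> complex) \<Rightarrow> (real \<Rightarrow> complex) \<Rightarrow> (real \<Rightarrow> complex) \<Rightarrow> real \<Rightarrow> complex" where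
  "S_plus_log t0 a d f t = S_fun a d t + hderiv t0 f t / f t"

definition D1 ::
  "real \<Rightarrow> (real \<Rightarrow> complex) \<Rightarrow> (real \<Rightarrow> complex) \<Rightarrow> (real \<Rightarrow> complex) \<Rightarrow> (real \<Rightarrow> complex) \<Rightarrow>
   real \<Rightarrow> complex" where
  "D1 t0 a b c d t =
     (a t * hderiv t0 b t - hderiv t0 a t * b t) / b t + a t * d t - b t * c t"

definition G1 ::
  "real \<Rightarrow> (real \<Rightarrow> complex) \<Rightarrow> (real \<Rightarrow> complex) \<Rightarrow> (real \<Rightarrow> complex) \<Rightarrow> (real \<Rightarrow> complex) \<Rightarrow>
   real \<Rightarrow> complex" where
  "G1 t0 a b c d t =
     D1 t0 a b c d t + 1/2 * hderiv t0 (S_plus_log t0 a d b) t - 1/4 * (S_plus_log t0 a d b t)\<^sup>2"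

text \<open>\<open>G1\<close> as a real-valued function; it agrees with \<open>G1\<close> where the latter is real.\<close>

definition G1r ::
  "real \<Rightarrow> (real \<Rightarrow> complex) \<Rightarrow> (real \<Rightarrow> complex) \<Rightarrow> (real \<Rightarrow> complex) \<Rightarrow> (real \<Rightarrow> complex) \<Rightarrow>
   real \<Rightarrow> real" where
  "G1r t0 a b c d t = Re (G1 t0 a b c d t)"

definition L1 ::
  "real \<Rightarrow> (real \<Rightarrow> complex) \<Rightarrow> (real \<Rightarrow> complex) \<Rightarrow> (real \<Rightarrow> complex) \<Rightarrow> (real \<Rightarrow> complex) \<Rightarrow>
   real \<Rightarrow> real" where
  "L1 t0 a b c d t =
     1 / root 4 (G1r t0 a b c d t) *
     integral {t0..t}
       (\<lambda>\<tau>. \<bar>hderiv t0 (\<lambda>s. sqrt (G1r t0 a b c d s)) \<tau>\<bar> / root 4 (G1r t0 a b c d \<tau>))"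

end

theory Submission
  imports Defs
begin

text \<open>With \<open>P = S + b'/b\<close> and \<open>E = exp (\<integral> P / 2)\<close>, the function \<open>u = \<phi> / E\<close> solves \<open>u'' + G1 u = 0\<close>.
  In the coordinates \<open>v = G1\<^sup>1\<^sup>/\<^sup>4 u\<close>, \<open>w = u' / G1\<^sup>1\<^sup>/\<^sup>4\<close> this is a rotation with a
  perturbation governed by \<open>\<gamma> = G1' / (4 G1\<^sup>3\<^sup>/\<^sup>2)\<close>, which has bounded variation and a limit
  in \<open>(-1, 1)\<close>; the quadratic form \<open>|v|\<^sup>2 + 2 \<gamma> Re (v w\<^sup>*) + |w|\<^sup>2\<close> is eventually positive definite and
  changes only by a bounded factor, so \<open>v\<close> and \<open>w\<close> stay bounded. As the Wronskian is constant,
  a fundamental matrix in these coordinates also has a bounded inverse. Hence boundedness (decay) of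
  all \<open>\<phi> = E v / G1\<^sup>1\<^sup>/\<^sup>4\<close> and \<open>\<phi>' = E (G1\<^sup>1\<^sup>/\<^sup>4 w + P v / (2 G1\<^sup>1\<^sup>/\<^sup>4))\<close> is boundedness (decay)
  of the amplitudes \<open>|E| (1 + |P|) / G1\<^sup>1\<^sup>/\<^sup>4\<close> and \<open>|E| G1\<^sup>1\<^sup>/\<^sup>4\<close>, whose logarithms are, up to
  factors and constants, the two expressions of the criterion.\<close>

section \<open>Global solutions of Lipschitz equations\<close>

lemma integral_has_vector_derivative_atLeast:
  fixes f :: "real \<Rightarrow> 'a::banach"
  assumes "continuous_on {t0..} f" and "t \<ge> t0"
  shows "((\<lambda>t. integral {t0..t} f) has_vector_derivative f t) (at t within {t0..})"
proof -
  have "((\<lambda>t. integral {t0..t} f) has_vector_derivative f t) (at t within {t0..t+1})"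
    using assms by (intro integral_has_vector_derivative) (auto intro: continuous_on_subset)
  \<comment> \<open>Differentiability is local: both filters agree because \<open>t + 1\<close> lies
    strictly beyond \<open>t\<close>.\<close>
  moreover have "at t within {t0..t+1} = at t within {t0..}"
    by (rule at_within_nhd[of t "{..<t+1}"]) auto
  ultimately show ?thesis by simp
qed

lemma vector_differentiable_bound_Icc:
  fixes f :: "real \<Rightarrow> 'a::real_normed_vector"
  assumes "\<And>t. t \<in> {x..y} \<Longrightarrow> (f has_vector_derivative f' t) (at t within {x..y})"
    and "\<And>t. t \<in> {x..y} \<Longrightarrow> norm (f' t) \<le> B" and "x \<le> y"
  shows "norm (f y - f x) \<le> B * (y - x)"
proof -
  have "norm (f y - f x) \<le> B * norm (y - x)"
  proof (rule differentiable_bound[of "{x..y}"])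
    show "(f has_derivative (\<lambda>h. h *\<^sub>R f' t)) (at t within {x..y})" if "t \<in> {x..y}" for t
      using assms(1)[OF that] by (simp add: has_vector_derivative_def)
    show "onorm (\<lambda>h. h *\<^sub>R f' t) \<le> B" if "t \<in> {x..y}" for t
      using assms(2)[OF that] by (simp add: onorm_scaleR_left bounded_linear_ident onorm_id)
  qed (use assms(3) in auto)
  then show ?thesis using assms(3) by simp
qed

text \<open>Picard's operator contracts by the factor \<open>1/2\<close> on all of \<open>[t0, \<infinity>)\<close> at once in the norm
  weighted with \<open>exp (- 2 \<integral> l)\<close>.\<close>

lemma lipschitz_ode_global_solution:
  fixes f :: "real \<Rightarrow> 'a::banach \<Rightarrow> 'a"
  assumes f: "continuous_on ({t0..} \<times> UNIV) (\<lambda>(t, x). f t x)"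
    and l: "continuous_on {t0..} l" and l0: "\<And>t. t \<ge> t0 \<Longrightarrow> 0 \<le> l t"
    and lip: "\<And>t x y. t \<ge> t0 \<Longrightarrow> norm (f t x - f t y) \<le> l t * norm (x - y)"
    and zero: "\<And>t. t \<ge> t0 \<Longrightarrow> f t 0 = 0"
  shows "\<exists>x. x t0 = x0 \<and> (\<forall>t\<ge>t0. (x has_vector_derivative f t (x t)) (at t within {t0..}))"
proof -
  define L where "L t = integral {t0..t} l" for t
  \<comment> \<open>The unknown is rescaled to \<open>y = exp (- 2 L) x\<close> and sought among
    bounded functions. \<open>F y\<close> is the right-hand side along \<open>x\<close>, and
    \<open>w\<close> is Picard's operator expressed in \<open>y\<close>.\<close>
  define F where "F y t = f t (exp (2 * L t) *\<^sub>R y t)" for y :: "real \<Rightarrow> 'a" and t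
  define w where "w y t = exp (- 2 * L t) *\<^sub>R (x0 + integral {t0..t} (F y))" for y t
  have L': "(L has_vector_derivative l t) (at t within {t0..})" if "t \<ge> t0" for t
    unfolding L_def using integral_has_vector_derivative_atLeast[OF l that] .
  have L_cont: "continuous_on {t0..} L"
    using L' by (intro continuous_on_vector_derivative) auto
  have L0: "0 \<le> L t" if "t \<ge> t0" for t
    unfolding L_def using that l l0
    by (intro integral_nonneg integrable_continuous_real) (auto intro: continuous_on_subset)
  have F_cont: "continuous_on {t0..} (F y)" if "continuous_on UNIV y" for y
  proof -
    have "continuous_on {t0..} (\<lambda>t. (\<lambda>(t, x). f t x) (t, exp (2 * L t) *\<^sub>R y t))"
      using that by (intro continuous_on_compose2[OF f] continuous_intros L_cont)
        (auto intro: continuous_on_subset)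
    then show ?thesis by (simp add: F_def[abs_def])
  qed
  \<comment> \<open>The factor 1/2 arises here: \<open>l * exp (2 * L)\<close> is the derivative of
    \<open>exp (2 * L) / 2\<close>, and the weight cancels this growth.\<close>
  have weight: "norm (exp (- 2 * L t) *\<^sub>R integral {t0..t} h) \<le> C / 2"
    if h: "continuous_on {t0..} h" and t: "t \<ge> t0" and C: "0 \<le> C"
      and le: "\<And>s. s \<ge> t0 \<Longrightarrow> norm (h s) \<le> l s * exp (2 * L s) * C" for h :: "real \<Rightarrow> 'a" and t C
  proof -
    have "((\<lambda>s. l s * exp (2 * L s) * C) has_integral exp (2 * L t) * C / 2 - exp (2 * L t0) * C / 2) {t0..t}"
    proof (rule fundamental_theorem_of_calculus[OF t])
      fix s assume "s \<in> {t0..t}"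
      then have "(L has_real_derivative l s) (at s within {t0..t})"
        using L'[of s] by (auto simp: has_real_derivative_iff_has_vector_derivative
            intro: has_vector_derivative_within_subset)
      then show "((\<lambda>s. exp (2 * L s) * C / 2) has_vector_derivative l s * exp (2 * L s) * C) (at s within {t0..t})"
        unfolding has_real_derivative_iff_has_vector_derivative[symmetric]
        by (auto intro!: derivative_eq_intros)
    qed
    moreover have "norm (integral {t0..t} h) \<le> integral {t0..t} (\<lambda>s. l s * exp (2 * L s) * C)"
      using h le l L_cont by (intro integral_norm_bound_integral integrable_continuous_real continuous_intros)
        (auto intro: continuous_on_subset)
    ultimately have "norm (integral {t0..t} h) \<le> exp (2 * L t) * C / 2 - exp (2 * L t0) * C / 2"
      by (metis integral_unique)
    also have "\<dots> \<le> exp (2 * L t) * C / 2" using C by simp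
    finally have "norm (integral {t0..t} h) \<le> exp (2 * L t) * C / 2" .
    then have "exp (- 2 * L t) * norm (integral {t0..t} h) \<le> exp (- 2 * L t) * (exp (2 * L t) * C / 2)"
      by (intro mult_left_mono) auto
    then show ?thesis by (simp add: exp_minus field_simps)
  qed
  have w_cont: "continuous_on {t0..} (w y)" if "continuous_on UNIV y" for y
  proof -
    have "continuous_on {t0..} (\<lambda>t. integral {t0..t} (F y))"
      using integral_has_vector_derivative_atLeast[OF F_cont[OF that]]
      by (intro continuous_on_vector_derivative) auto
    then show ?thesis
      unfolding w_def[abs_def] by (intro continuous_intros L_cont)
  qed
  \<comment> \<open>Elements of \<open>bcontfun\<close> live on the whole line, so the operator's
    value is extended constantly to the left of \<open>t0\<close> through
    \<open>max t0 s\<close>.\<close>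
  have w_bcont: "(\<lambda>s. w (apply_bcontfun y) (max t0 s)) \<in> bcontfun" for y :: "real \<Rightarrow>\<^sub>C 'a"
  proof (rule bcontfun_normI)
    show "continuous_on UNIV (\<lambda>s. w (apply_bcontfun y) (max t0 s))"
      by (rule continuous_on_compose2[OF w_cont]) (auto intro!: continuous_intros)
    fix s
    let ?t = "max t0 s"
    have "norm (exp (- 2 * L ?t) *\<^sub>R integral {t0..?t} (F y)) \<le> norm y / 2"
    proof (rule weight[OF F_cont])
      fix r assume "r \<ge> t0"
      \<comment> \<open>Comparison with the zero solution turns the Lipschitz condition into linear
        growth, so the operator preserves boundedness.\<close>
      then have "norm (F y r) \<le> l r * norm (exp (2 * L r) *\<^sub>R y r)"
        using lip[of r "exp (2 * L r) *\<^sub>R y r" 0] by (simp add: F_def zero)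
      also have "\<dots> \<le> l r * (exp (2 * L r) * norm y)"
        using l0[OF \<open>r \<ge> t0\<close>] norm_bounded[of y r] by (intro mult_left_mono) auto
      finally show "norm (F y r) \<le> l r * exp (2 * L r) * norm y" by (simp add: mult.assoc)
    qed auto
    moreover have "norm (exp (- 2 * L ?t) *\<^sub>R x0) \<le> norm x0"
      using L0[of ?t] by (simp add: mult_left_le_one_le)
    ultimately show "norm (w y ?t) \<le> norm x0 + norm y / 2"
      unfolding w_def scaleR_add_right by (intro norm_triangle_mono)
  qed
  define Op where "Op y = Bcontfun (\<lambda>s. w (apply_bcontfun y) (max t0 s))" for y :: "real \<Rightarrow>\<^sub>C 'a"
  have Op: "apply_bcontfun (Op y) s = w y (max t0 s)" for y s
    unfolding Op_def by (simp add: Bcontfun_inverse[OF w_bcont])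
  have "dist (Op y) (Op z) \<le> 1/2 * dist y z" for y z
  proof (rule dist_bound)
    fix s
    let ?t = "max t0 s"
    have int: "F u integrable_on {t0..?t}" if "continuous_on UNIV u" for u
      by (rule integrable_continuous_real, rule continuous_on_subset[OF F_cont[OF that]]) auto
    have "w y ?t - w z ?t = exp (- 2 * L ?t) *\<^sub>R integral {t0..?t} (\<lambda>r. F y r - F z r)"
      unfolding w_def by (simp add: integral_diff int scaleR_diff_right scaleR_add_right)
    moreover have "norm (exp (- 2 * L ?t) *\<^sub>R integral {t0..?t} (\<lambda>r. F y r - F z r)) \<le> dist y z / 2"
    proof (rule weight)
      show "continuous_on {t0..} (\<lambda>r. F y r - F z r)" by (intro continuous_intros F_cont) auto
      fix r assume r: "r \<ge> t0"
      have "norm (F y r - F z r) \<le> l r * norm (exp (2 * L r) *\<^sub>R (y r - z r))"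
        unfolding F_def scaleR_diff_right by (rule lip[OF r])
      also have "\<dots> \<le> l r * (exp (2 * L r) * dist y z)"
        using l0[OF r] dist_bounded[of y r z] by (intro mult_left_mono) (auto simp: dist_norm)
      finally show "norm (F y r - F z r) \<le> l r * exp (2 * L r) * dist y z" by (simp add: mult.assoc)
    qed auto
    ultimately show "dist (Op y s) (Op z s) \<le> 1/2 * dist y z"
      by (simp add: Op dist_norm)
  qed
  then obtain y where y: "Op y = y"
    using banach_fix_type[of "1/2" Op] by auto
  define x where "x t = exp (2 * L t) *\<^sub>R y t" for t
  have x: "x t = x0 + integral {t0..t} (F y)" if "t \<ge> t0" for t
  proof -
    have "y t = w y t" using Op[of y t] that by (simp add: y max_absorb2)
    then show ?thesis by (simp add: x_def w_def exp_minus)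
  qed
  have "(x has_vector_derivative f t (x t)) (at t within {t0..})" if t: "t \<ge> t0" for t
  proof (rule has_vector_derivative_transform[where f = "\<lambda>t. x0 + integral {t0..t} (F y)"])
    have "((\<lambda>t. x0 + integral {t0..t} (F y)) has_vector_derivative F y t) (at t within {t0..})"
      using integral_has_vector_derivative_atLeast[OF F_cont t] by (auto intro!: derivative_eq_intros)
    then show "((\<lambda>t. x0 + integral {t0..t} (F y)) has_vector_derivative f t (x t)) (at t within {t0..})"
      by (simp add: F_def x_def)
  qed (use t x in auto)
  moreover have "x t0 = x0" using x[of t0] by simp
  ultimately show ?thesis by blast
qed

text \<open>By linearity the growth bound of the right-hand side is also a Lipschitz bound, with the
  sum of the moduli of the four coefficients as factor. Free initial values make a fundamental pair
  available.\<close>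

lemma linear_system_solution_exists:
  assumes "continuous_on {t0..} a" "continuous_on {t0..} b" "continuous_on {t0..} c" "continuous_on {t0..} d"
  shows "\<exists>\<phi> \<psi>. \<phi> t0 = p \<and> \<psi> t0 = q \<and> is_solution t0 a b c d \<phi> \<psi>"
proof -
  define f where "f t z = (a t * fst z + b t * snd z, c t * fst z + d t * snd z)" for t and z :: "complex \<times> complex"
  let ?l = "\<lambda>t. cmod (a t) + cmod (b t) + cmod (c t) + cmod (d t)"
  have cont: "continuous_on ({t0..} \<times> UNIV) (\<lambda>(t, x). f t x)"
  proof -
    have "continuous_on ({t0..} \<times> UNIV) (\<lambda>z :: real \<times> complex \<times> complex. h (fst z))" if "continuous_on {t0..} h" for h :: "real \<Rightarrow> complex"
      by (rule continuous_on_compose2[OF that]) (auto intro!: continuous_intros)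
    with assms show ?thesis
      unfolding f_def split_beta by (intro continuous_intros) auto
  qed
  have bound: "norm (f t z) \<le> ?l t * norm z" for t z
  proof -
    have "norm (f t z) \<le> cmod (a t * fst z + b t * snd z) + cmod (c t * fst z + d t * snd z)"
      unfolding f_def by (rule norm_Pair_le)
    also have "\<dots> \<le> (cmod (a t) * norm z + cmod (b t) * norm z) + (cmod (c t) * norm z + cmod (d t) * norm z)"
      using norm_fst_le[of "fst z" "snd z"] norm_snd_le[of "snd z" "fst z"]
      by (intro add_mono norm_triangle_mono) (auto simp: norm_mult intro!: mult_left_mono)
    finally show ?thesis by (simp add: algebra_simps)
  qed
  obtain x where x: "x t0 = (p, q)" "\<And>t. t \<ge> t0 \<Longrightarrow> (x has_vector_derivative f t (x t)) (at t within {t0..})"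
  proof -
    have "\<exists>x. x t0 = (p, q) \<and> (\<forall>t\<ge>t0. (x has_vector_derivative f t (x t)) (at t within {t0..}))"
    proof (rule lipschitz_ode_global_solution[OF cont])
      show "continuous_on {t0..} ?l" by (intro continuous_intros assms)
      show "norm (f t x - f t y) \<le> ?l t * norm (x - y)" for t x y
        using bound[of t "x - y"] by (simp add: f_def algebra_simps)
      show "f t 0 = 0" for t
        by (simp add: f_def zero_prod_def)
    qed auto
    then show ?thesis using that by blast
  qed
  have "is_solution t0 a b c d (\<lambda>t. fst (x t)) (\<lambda>t. snd (x t))"
    unfolding is_solution_def
  proof (intro allI impI conjI)
    fix t assume "t \<ge> t0"
    from x(2)[OF this] show "((\<lambda>t. fst (x t)) has_vector_derivative a t * fst (x t) + b t * snd (x t)) (at t within {t0..})"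
      "((\<lambda>t. snd (x t)) has_vector_derivative c t * fst (x t) + d t * snd (x t)) (at t within {t0..})"
      by (auto dest: bounded_linear.has_vector_derivative[OF bounded_linear_fst]
          bounded_linear.has_vector_derivative[OF bounded_linear_snd] simp: f_def)
  qed
  with x(1) show ?thesis by (intro exI[of _ "\<lambda>t. fst (x t)"] exI[of _ "\<lambda>t. snd (x t)"]) auto
qed

section \<open>Oscillators with coefficients of bounded variation\<close>

text \<open>Each factor \<open>1 + k i\<close> is at most \<open>exp (k i)\<close>, and an error
  \<open>h\<close> made at any step is later amplified by no more than the full product.\<close>

lemma discrete_gronwall:
  fixes q k :: "nat \<Rightarrow> real"
  assumes "\<And>i. i < n \<Longrightarrow> q (Suc i) \<le> (1 + k i) * q i + h"
    and "\<And>i. i < n \<Longrightarrow> 0 \<le> k i" and "0 \<le> q 0" and "0 \<le> h"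
  shows "q n \<le> exp (\<Sum>i<n. k i) * (q 0 + n * h)"
  using assms(1,2)
proof (induction n)
  case 0
  then show ?case by simp
next
  case (Suc n)
  let ?K = "\<Sum>i<n. k i"
  have K0: "0 \<le> ?K" "0 \<le> k n" using Suc.prems(2) by (auto intro: sum_nonneg)
  have "q (Suc n) \<le> (1 + k n) * q n + h" using Suc.prems(1) by simp
  also have "\<dots> \<le> exp (k n) * (exp ?K * (q 0 + n * h)) + exp (?K + k n) * h"
  proof (rule add_mono)
    have "(1 + k n) * q n \<le> (1 + k n) * (exp ?K * (q 0 + n * h))"
      using Suc.IH Suc.prems K0 by (intro mult_left_mono) auto
    also have "\<dots> \<le> exp (k n) * (exp ?K * (q 0 + n * h))"
      using assms(3,4) exp_ge_add_one_self[of "k n"] by (intro mult_right_mono) auto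
    finally show "(1 + k n) * q n \<le> exp (k n) * (exp ?K * (q 0 + n * h))" .
    have "1 \<le> exp (?K + k n)" using K0 by simp
    then show "h \<le> exp (?K + k n) * h"
      using assms(4) by (simp add: mult_le_cancel_right1)
  qed
  also have "\<dots> = exp (\<Sum>i<Suc n. k i) * (q 0 + Suc n * h)"
    by (simp add: exp_add algebra_simps)
  finally show ?case .
qed

text \<open>If \<open>\<gamma>\<close> were differentiable, \<open>Q = |v|\<^sup>2 + 2 \<gamma> (v \<bullet> w) + |w|\<^sup>2\<close> would satisfy
  \<open>Q' = 2 \<gamma>' (v \<bullet> w)\<close>. Since \<open>\<gamma>\<close> is only of bounded variation, Gronwall's argument is run along
  partitions, freezing \<open>\<gamma>\<close> on each interval: the frozen form has derivative
  \<open>2 g (\<gamma> - c) (|v|\<^sup>2 - |w|\<^sup>2)\<close>, which contributes nothing in the limit of vanishing mesh.\<close>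

lemma oscillator_bounded:
  fixes v w :: "real \<Rightarrow> 'a::real_inner" and \<gamma> g :: "real \<Rightarrow> real"
  assumes v: "\<And>t. t \<ge> T \<Longrightarrow> (v has_vector_derivative g t *\<^sub>R (\<gamma> t *\<^sub>R v t + w t)) (at t within {T..})"
    and w: "\<And>t. t \<ge> T \<Longrightarrow> (w has_vector_derivative - (g t *\<^sub>R (\<gamma> t *\<^sub>R w t + v t))) (at t within {T..})"
    and \<gamma>: "continuous_on {T..} \<gamma>" and g: "continuous_on {T..} g"
    and \<rho>: "\<And>t. t \<ge> T \<Longrightarrow> \<bar>\<gamma> t\<bar> \<le> \<rho>" "\<rho> < 1"
    and var: "\<And>n x. mono_on {..n} x \<Longrightarrow> x 0 = T \<Longrightarrow> (\<Sum>i<n. \<bar>\<gamma> (x (Suc i)) - \<gamma> (x i)\<bar>) \<le> M"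
  shows "\<exists>C. \<forall>t\<ge>T. (norm (v t))\<^sup>2 + (norm (w t))\<^sup>2 \<le> C"
proof -
  define Q where "Q c t = v t \<bullet> v t + 2 * c * (v t \<bullet> w t) + w t \<bullet> w t" for c t
  define N where "N t = v t \<bullet> v t + w t \<bullet> w t" for t
  \<comment> \<open>The mixed term of \<open>Q (\<gamma> t)\<close> is at most
    \<open>\<rho> * N t\<close> in modulus, so the form dominates \<open>(1 - \<rho>) * N t\<close>;
    \<open>K\<close> is the resulting constant.\<close>
  define K where "K = 1 / (1 - \<rho>)"
  have K: "0 < K" using \<rho>(2) by (simp add: K_def)
  have vw: "2 * \<bar>v t \<bullet> w t\<bar> \<le> N t" for t
  proof -
    have "0 \<le> (v t - w t) \<bullet> (v t - w t)" "0 \<le> (v t + w t) \<bullet> (v t + w t)" by (rule inner_ge_zero)+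
    then show ?thesis by (simp add: N_def algebra_simps inner_commute abs_le_iff)
  qed
  have N0: "0 \<le> N t" for t by (simp add: N_def)
  have NQ: "N t \<le> K * Q (\<gamma> t) t" if "t \<ge> T" for t
  proof -
    have "\<bar>2 * \<gamma> t * (v t \<bullet> w t)\<bar> = \<bar>\<gamma> t\<bar> * (2 * \<bar>v t \<bullet> w t\<bar>)" by (simp add: abs_mult)
    also have "\<dots> \<le> \<rho> * N t"
      using \<rho>(1)[OF that] vw[of t] by (intro mult_mono) auto
    finally have "(1 - \<rho>) * N t \<le> Q (\<gamma> t) t" by (simp add: Q_def N_def algebra_simps abs_le_iff)
    then show ?thesis using \<rho>(2) by (simp add: K_def field_simps)
  qed
  have Q0: "0 \<le> Q (\<gamma> t) t" if "t \<ge> T" for t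
    using NQ[OF that] N0[of t] K by (metis order_trans zero_le_mult_iff less_le_not_le)
  have Q': "(Q c has_vector_derivative 2 * g t * (\<gamma> t - c) * (v t \<bullet> v t - w t \<bullet> w t)) (at t within {T..})"
    if "t \<ge> T" for c t
  proof -
    note der = bounded_bilinear.has_vector_derivative[OF bounded_bilinear_inner]
    let ?v = "g t *\<^sub>R (\<gamma> t *\<^sub>R v t + w t)" and ?w = "- (g t *\<^sub>R (\<gamma> t *\<^sub>R w t + v t))"
    have "(Q c has_vector_derivative (v t \<bullet> ?v + ?v \<bullet> v t) + 2 * c * (v t \<bullet> ?w + ?v \<bullet> w t)
        + (w t \<bullet> ?w + ?w \<bullet> w t)) (at t within {T..})"
      unfolding Q_def using der[OF v[OF that] v[OF that]] der[OF v[OF that] w[OF that]] der[OF w[OF that] w[OF that]]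
      by (intro has_vector_derivative_add has_vector_derivative_mult_right)
    moreover have "(v t \<bullet> ?v + ?v \<bullet> v t) + 2 * c * (v t \<bullet> ?w + ?v \<bullet> w t) + (w t \<bullet> ?w + ?w \<bullet> w t)
       = 2 * g t * (\<gamma> t - c) * (v t \<bullet> v t - w t \<bullet> w t)"
      by (simp add: inner_add_left inner_add_right inner_commute algebra_simps)
    ultimately show ?thesis by simp
  qed
  have cont: "continuous_on {T..} v" "continuous_on {T..} w"
    by (rule continuous_on_vector_derivative, use v w in force)+
  have "Q (\<gamma> t) t \<le> exp (K * M) * Q (\<gamma> T) T" if t: "t \<ge> T" for t
  proof (rule field_le_epsilon)
    fix e :: real assume "e > 0"
    \<comment> \<open>An error \<open>e\<close> is allowed after multiplication by the Gronwall
      factor, hence \<open>\<eta>\<close> before it.\<close>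
    define \<eta> where "\<eta> = e / exp (K * M)"
    have \<eta>: "\<eta> > 0" using \<open>e > 0\<close> by (simp add: \<eta>_def)
    have "continuous_on {T..t} (\<lambda>s. 2 * g s * (v s \<bullet> v s - w s \<bullet> w s))"
      by (intro continuous_intros continuous_on_subset[OF g] continuous_on_subset[OF cont(1)]
          continuous_on_subset[OF cont(2)]) auto
    then have "bounded ((\<lambda>s. 2 * g s * (v s \<bullet> v s - w s \<bullet> w s)) ` {T..t})"
      by (intro compact_imp_bounded compact_continuous_image) auto
    then obtain B where B: "B > 0" "\<And>s. s \<in> {T..t} \<Longrightarrow> \<bar>2 * g s * (v s \<bullet> v s - w s \<bullet> w s)\<bar> \<le> B"
      unfolding bounded_pos by (auto simp: image_iff)
    \<comment> \<open>Over \<open>n\<close> steps of length \<open>h\<close> the freezing errors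
      \<open>\<epsilon> * B * h\<close> then add up to at most \<open>\<eta>\<close>; the summand 1
      in the denominator covers \<open>t = T\<close>.\<close>
    define \<epsilon> where "\<epsilon> = \<eta> / (B * (t - T + 1))"
    have \<epsilon>: "\<epsilon> > 0" using \<eta> B t by (simp add: \<epsilon>_def)
    have "uniformly_continuous_on {T..t} \<gamma>"
      by (intro compact_uniformly_continuous continuous_on_subset[OF \<gamma>]) auto
    then obtain \<delta> where \<delta>: "\<delta> > 0"
      "\<And>x y. x \<in> {T..t} \<Longrightarrow> y \<in> {T..t} \<Longrightarrow> \<bar>x - y\<bar> < \<delta> \<Longrightarrow> \<bar>\<gamma> x - \<gamma> y\<bar> < \<epsilon>"
      using \<epsilon> unfolding uniformly_continuous_on_def dist_real_def by metis
    obtain n :: nat where n: "(t - T) / \<delta> < n" using reals_Archimedean2 by blast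
    have n0: "0 < n" using n t \<delta> by (metis divide_nonneg_pos diff_ge_0_iff_ge gr0I not_less of_nat_0)
    define h where "h = (t - T) / n"
    have h: "0 \<le> h" "h < \<delta>" using n n0 t \<delta> by (auto simp: h_def field_simps)
    define x where "x i = T + i * h" for i :: nat
    have x: "x i \<in> {T..t}" if "i \<le> n" for i
    proof -
      have "i * h \<le> n * h" using that h by (intro mult_right_mono) auto
      moreover have "0 \<le> i * h" using h by simp
      moreover have "n * h = t - T" using n0 by (simp add: h_def)
      ultimately show ?thesis by (simp add: x_def)
    qed
    \<comment> \<open>Time moves first, from \<open>?x\<close> to \<open>?y\<close>, with the
      parameter frozen at its right-endpoint value \<open>\<gamma> ?y\<close>; this costs
      \<open>\<epsilon> * B * h\<close>. Then, at the fixed time \<open>?x\<close>, the parameter is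
      switched between \<open>\<gamma> ?y\<close> and \<open>\<gamma> ?x\<close>; this costs the
      increment of \<open>\<gamma>\<close> times \<open>K * Q\<close>.\<close>
    have step: "Q (\<gamma> (x (Suc i))) (x (Suc i)) \<le>
        (1 + K * \<bar>\<gamma> (x (Suc i)) - \<gamma> (x i)\<bar>) * Q (\<gamma> (x i)) (x i) + \<epsilon> * B * h" if i: "i < n" for i
    proof -
      let ?x = "x i" and ?y = "x (Suc i)"
      have xy: "?y - ?x = h" "?x \<in> {T..t}" "?y \<in> {T..t}" using i x[of i] x[of "Suc i"] by (auto simp: x_def algebra_simps)
      have "norm (Q (\<gamma> ?y) ?y - Q (\<gamma> ?y) ?x) \<le> (\<epsilon> * B) * (?y - ?x)"
      proof (rule vector_differentiable_bound_Icc)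
        fix s assume s: "s \<in> {?x..?y}"
        then have sT: "s \<in> {T..t}" using xy by auto
        show "(Q (\<gamma> ?y) has_vector_derivative 2 * g s * (\<gamma> s - \<gamma> ?y) * (v s \<bullet> v s - w s \<bullet> w s)) (at s within {?x..?y})"
          using sT xy by (intro has_vector_derivative_within_subset[OF Q']) auto
        have "\<bar>\<gamma> s - \<gamma> ?y\<bar> < \<epsilon>" using s xy h by (intro \<delta> sT) auto
        then have "\<bar>\<gamma> s - \<gamma> ?y\<bar> * \<bar>2 * g s * (v s \<bullet> v s - w s \<bullet> w s)\<bar> \<le> \<epsilon> * B"
          using B(2)[OF sT] by (intro mult_mono) auto
        then show "norm (2 * g s * (\<gamma> s - \<gamma> ?y) * (v s \<bullet> v s - w s \<bullet> w s)) \<le> \<epsilon> * B"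
          unfolding abs_mult[symmetric] real_norm_def by (simp only: mult_ac)
      qed (use xy h in auto)
      then have "Q (\<gamma> ?y) ?y \<le> Q (\<gamma> ?y) ?x + \<epsilon> * B * h" using xy by (simp add: abs_le_iff)
      moreover have "Q (\<gamma> ?y) ?x = Q (\<gamma> ?x) ?x + (\<gamma> ?y - \<gamma> ?x) * (2 * (v ?x \<bullet> w ?x))"
        by (simp add: Q_def algebra_simps)
      moreover have "(\<gamma> ?y - \<gamma> ?x) * (2 * (v ?x \<bullet> w ?x)) \<le> \<bar>\<gamma> ?y - \<gamma> ?x\<bar> * (2 * \<bar>v ?x \<bullet> w ?x\<bar>)"
        by (rule order_trans[OF abs_ge_self]) (simp add: abs_mult)
      moreover have "\<bar>\<gamma> ?y - \<gamma> ?x\<bar> * (2 * \<bar>v ?x \<bullet> w ?x\<bar>) \<le> \<bar>\<gamma> ?y - \<gamma> ?x\<bar> * (K * Q (\<gamma> ?x) ?x)"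
        using vw[of ?x] NQ[of ?x] xy by (intro mult_left_mono) auto
      ultimately show ?thesis by (simp add: algebra_simps)
    qed
    have sum: "(\<Sum>i<n. \<bar>\<gamma> (x (Suc i)) - \<gamma> (x i)\<bar>) \<le> M"
    proof (rule var)
      show "mono_on {..n} x" using h by (auto simp: mono_on_def x_def intro!: mult_right_mono)
    qed (simp add: x_def)
    have "Q (\<gamma> (x n)) (x n) \<le> exp (\<Sum>i<n. K * \<bar>\<gamma> (x (Suc i)) - \<gamma> (x i)\<bar>) *
        (Q (\<gamma> (x 0)) (x 0) + n * (\<epsilon> * B * h))"
    proof (rule discrete_gronwall)
      show "0 \<le> Q (\<gamma> (x 0)) (x 0)" by (intro Q0) (simp add: x_def)
      show "0 \<le> \<epsilon> * B * h" using \<epsilon> B h by simp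
    qed (use step K in auto)
    also have "\<dots> \<le> exp (K * M) * (Q (\<gamma> T) T + \<eta>)"
    proof (intro mult_mono)
      show "exp (\<Sum>i<n. K * \<bar>\<gamma> (x (Suc i)) - \<gamma> (x i)\<bar>) \<le> exp (K * M)"
        using sum K by (simp add: sum_distrib_left[symmetric])
      have "n * (\<epsilon> * B * h) = \<eta> * ((t - T) / (t - T + 1))"
      proof -
        have "n * h = t - T" "\<epsilon> * B = \<eta> / (t - T + 1)"
          using n0 B t by (simp_all add: h_def \<epsilon>_def)
        moreover have "n * (\<epsilon> * B * h) = \<epsilon> * B * (n * h)" by simp
        ultimately show ?thesis by simp
      qed
      also have "\<dots> \<le> \<eta> * 1" using \<eta> t by (intro mult_left_mono) auto
      finally show "Q (\<gamma> (x 0)) (x 0) + n * (\<epsilon> * B * h) \<le> Q (\<gamma> T) T + \<eta>" by (simp add: x_def)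
      show "0 \<le> Q (\<gamma> (x 0)) (x 0) + n * (\<epsilon> * B * h)"
        using Q0[of T] \<epsilon> B h by (simp add: x_def)
    qed simp
    also have "\<dots> = exp (K * M) * Q (\<gamma> T) T + e" by (simp add: \<eta>_def field_simps)
    finally show "Q (\<gamma> t) t \<le> exp (K * M) * Q (\<gamma> T) T + e"
      using n0 by (simp add: x_def h_def)
  qed
  then have "N t \<le> K * (exp (K * M) * Q (\<gamma> T) T)" if "t \<ge> T" for t
    using NQ[OF that] K that by (meson order_trans mult_left_mono less_imp_le)
  then show ?thesis by (auto simp: N_def power2_norm_eq_inner)
qed

text \<open>Prepending \<open>s\<close> to a partition that starts later adds one nonnegative
  summand. A variation bound counted from \<open>t0\<close> thus serves partitions that start at a
  later time.\<close>

lemma sum_le_total_var: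
  assumes x: "mono_on {..n} x" "x 0 = s'" and s: "s \<le> s'"
  shows "ereal (\<Sum>i<n. \<bar>f (x (Suc i)) - f (x i)\<bar>) \<le> total_var s (x n) f"
proof -
  define y where "y i = (case i of 0 \<Rightarrow> s | Suc j \<Rightarrow> x j)" for i :: nat
  have "x 0 \<le> x j" if "j \<le> n" for j using x(1) that by (auto simp: mono_on_def)
  then have "mono_on {..Suc n} y"
    using x s by (fastforce simp: mono_on_def y_def split: nat.splits)
  then have "ereal (\<Sum>i<Suc n. \<bar>f (y (Suc i)) - f (y i)\<bar>) \<le> total_var s (x n) f"
    unfolding total_var_def by (intro SUP_upper2[of "(Suc n, y)"]) (auto simp: y_def)
  moreover have "(\<Sum>i<n. \<bar>f (x (Suc i)) - f (x i)\<bar>) \<le> (\<Sum>i<Suc n. \<bar>f (y (Suc i)) - f (y i)\<bar>)"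
    unfolding sum.lessThan_Suc_shift by (simp add: y_def)
  ultimately show ?thesis by (meson order_trans ereal_less_eq(3))
qed

section \<open>Reduction to an oscillator\<close>

lemma SUP_ln_less_infinity_iff:
  fixes X :: "'a \<Rightarrow> real"
  assumes X: "\<And>t. t \<in> A \<Longrightarrow> X t > 0"
  shows "(SUP t\<in>A. ereal (2 * ln (X t) + k)) < \<infinity> \<longleftrightarrow> (\<exists>C. \<forall>t\<in>A. X t \<le> C)"
proof
  assume "(SUP t\<in>A. ereal (2 * ln (X t) + k)) < \<infinity>"
  then have "(SUP t\<in>A. ereal (2 * ln (X t) + k)) \<noteq> \<infinity>" by (rule less_imp_neq)
  then obtain n where n: "(SUP t\<in>A. ereal (2 * ln (X t) + k)) < ereal (real n)"
    unfolding less_PInf_Ex_of_nat by blast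
  have "X t \<le> exp ((n - k) / 2)" if "t \<in> A" for t
  proof -
    have "ereal (2 * ln (X t) + k) < ereal (real n)" by (rule le_less_trans[OF SUP_upper n]) fact
    then have "ln (X t) \<le> (n - k) / 2" by simp
    then have "exp (ln (X t)) \<le> exp ((n - k) / 2)" by (simp only: exp_le_cancel_iff)
    then show ?thesis using X[OF that] by simp
  qed
  then show "\<exists>C. \<forall>t\<in>A. X t \<le> C" by blast
next
  assume "\<exists>C. \<forall>t\<in>A. X t \<le> C"
  then obtain C where "\<And>t. t \<in> A \<Longrightarrow> X t \<le> C" by blast
  then have "(SUP t\<in>A. ereal (2 * ln (X t) + k)) \<le> ereal (2 * ln C + k)"
    using X by (intro SUP_least) (simp add: ln_mono)
  also have "\<dots> < \<infinity>" by simp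
  finally show "(SUP t\<in>A. ereal (2 * ln (X t) + k)) < \<infinity>" .
qed

lemma filterlim_ln_at_bot_iff:
  fixes X :: "'a \<Rightarrow> real"
  assumes X: "\<forall>\<^sub>F t in F. X t > 0"
  shows "filterlim (\<lambda>t. 2 * ln (X t) + k) at_bot F \<longleftrightarrow> (X \<longlongrightarrow> 0) F"
proof -
  have "filterlim (\<lambda>t. 2 * ln (X t) + k) at_bot F \<longleftrightarrow> filterlim (\<lambda>t. ln (X t)) at_bot F"
    using filterlim_tendsto_add_at_bot_iff[OF tendsto_const[of k F], of "\<lambda>t. 2 * ln (X t)"]
      filterlim_tendsto_pos_mult_at_bot_iff[OF tendsto_const[of "2::real" F], of "\<lambda>t. ln (X t)"]
    by (simp add: add.commute)
  also have "\<dots> \<longleftrightarrow> (X \<longlongrightarrow> 0) F"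
  proof
    assume "filterlim (\<lambda>t. ln (X t)) at_bot F"
    then have "((\<lambda>t. exp (ln (X t))) \<longlongrightarrow> 0) F" by (rule filterlim_compose[OF exp_at_bot])
    then show "(X \<longlongrightarrow> 0) F"
      by (rule Lim_transform_eventually) (use X in \<open>auto elim: eventually_mono\<close>)
  next
    assume "(X \<longlongrightarrow> 0) F"
    \<comment> \<open>Positivity makes \<open>X\<close> approach 0 from the right, where the
      logarithm tends to minus infinity.\<close>
    then have "filterlim X (at_right 0) F"
      using X by (auto simp: filterlim_at elim: eventually_mono)
    then show "filterlim (\<lambda>t. ln (X t)) at_bot F" by (rule filterlim_compose[OF ln_at_0])
  qed
  finally show ?thesis .
qed

section \<open>The reduced system and its oscillator coordinates\<close>

text \<open>Derivatives enter as explicit functions, so the calculations are free of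
  \<open>hderiv\<close>. \<open>P\<close> stands for S + b'/b and \<open>G\<close> for the
  real-valued \<open>G1\<close>.\<close>

locale reduced_system =
  fixes t0 \<alpha> :: real and a b c d a' b' P P' :: "real \<Rightarrow> complex" and G G' :: "real \<Rightarrow> real"
  assumes a: "\<And>t. t \<ge> t0 \<Longrightarrow> (a has_vector_derivative a' t) (at t within {t0..})"
    and b: "\<And>t. t \<ge> t0 \<Longrightarrow> (b has_vector_derivative b' t) (at t within {t0..})"
    and P: "\<And>t. t \<ge> t0 \<Longrightarrow> (P has_vector_derivative P' t) (at t within {t0..})"
    and G: "\<And>t. t \<ge> t0 \<Longrightarrow> (G has_vector_derivative G' t) (at t within {t0..})"
    and c_cont: "continuous_on {t0..} c" and d_cont: "continuous_on {t0..} d"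
    and G'_cont: "continuous_on {t0..} G'"
    and b_nz: "\<And>t. t \<ge> t0 \<Longrightarrow> b t \<noteq> 0"
    and G_pos: "\<And>t. t \<ge> t0 \<Longrightarrow> G t > 0"
    and P_eq: "\<And>t. t \<ge> t0 \<Longrightarrow> P t = a t + d t + b' t / b t"
    and G_eq: "\<And>t. t \<ge> t0 \<Longrightarrow> of_real (G t) =
      (a t * b' t - a' t * b t) / b t + a t * d t - b t * c t + 1/2 * P' t - 1/4 * (P t)\<^sup>2"
    and a_bdd: "bounded (a ` {t0..})" and b_bdd: "bounded (b ` {t0..})"
    and b_inv_bdd: "bounded ((\<lambda>t. 1 / b t) ` {t0..})"
    and lim: "((\<lambda>t. G' t / G t powr (3/2)) \<longlongrightarrow> \<alpha>) at_top" and \<alpha>: "\<bar>\<alpha>\<bar> < 4"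
    and var: "\<exists>M::real. \<forall>t\<ge>t0. total_var t0 t (\<lambda>s. G' s / G s powr (3/2)) \<le> ereal M"
begin

definition E where "E t = exp (integral {t0..t} P / 2)"
definition r where "r t = G t powr (1/4)"
definition \<gamma> where "\<gamma> t = G' t / G t powr (3/2) / 4"
definition v where "v \<phi> t = of_real (r t) * (\<phi> t * inverse (E t))"
text \<open>With \<open>u = \<phi> / E\<close> this is \<open>u' / r\<close>: the bracket is
  \<open>\<phi>' - P \<phi> / 2\<close> with \<open>\<phi>'\<close> replaced by the right-hand side
  of the system.\<close>

definition w where
  "w \<phi> \<psi> t = of_real (inverse (r t)) * ((a t * \<phi> t + b t * \<psi> t - P t / 2 * \<phi> t) * inverse (E t))"
text \<open>The factor \<open>1 + cmod (P t)\<close> gathers the two amplitudes of \<open>v\<close>: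
  \<open>E / r\<close> in \<open>\<phi>\<close> and, up to a factor 2, \<open>E P / (2 r)\<close> in
  \<open>\<phi>'\<close>. \<open>Y\<close> is the amplitude of \<open>w\<close> in
  \<open>\<phi>'\<close>.\<close>

definition X where "X t = cmod (E t) * (1 + cmod (P t)) / r t"
definition Y where "Y t = cmod (E t) * r t"

lemma continuous_coeffs:
  "continuous_on {t0..} a" "continuous_on {t0..} b" "continuous_on {t0..} P" "continuous_on {t0..} G"
  using a b P G by (auto intro!: continuous_on_vector_derivative)

lemma r_pos: "t \<ge> t0 \<Longrightarrow> r t > 0"
  using G_pos[of t] by (simp add: r_def)

lemma E_nz: "E t \<noteq> 0"
  by (simp add: E_def)

lemma r_cont: "continuous_on {t0..} r"
  unfolding r_def[abs_def] using G_pos by (intro continuous_intros continuous_coeffs) force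

lemma \<gamma>_cont: "continuous_on {t0..} \<gamma>"
  unfolding \<gamma>_def[abs_def] using G_pos by (intro continuous_intros continuous_coeffs G'_cont) force+

text \<open>The common value is the logarithmic derivative \<open>r' / r\<close> of the fourth root
  of \<open>G\<close>; this is how \<open>\<gamma>\<close> enters the equations for \<open>v\<close>
  and \<open>w\<close>.\<close>

lemma r_sq_\<gamma>: "t \<ge> t0 \<Longrightarrow> (r t)\<^sup>2 * \<gamma> t = G' t / (4 * G t)"
  using G_pos[of t] powr_mult_base[of "G t" "1/2"]
  by (auto simp: r_def \<gamma>_def powr_powr powr_realpow[symmetric] field_simps)

lemma r_fourth: "t \<ge> t0 \<Longrightarrow> r t ^ 4 = G t"
  using G_pos[of t] by (simp add: r_def powr_powr powr_realpow[symmetric])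

lemma r_deriv:
  assumes "t \<ge> t0"
  shows "(r has_real_derivative r t ^ 3 * \<gamma> t) (at t within {t0..})"
    and "((\<lambda>t. inverse (r t)) has_real_derivative - (r t * \<gamma> t)) (at t within {t0..})"
proof -
  have "(G has_real_derivative G' t) (at t within {t0..})"
    using G[OF assms] by (simp add: has_real_derivative_iff_has_vector_derivative)
  then have "((\<lambda>t. G t powr (1/4)) has_real_derivative (1/4 * G t powr (1/4 - 1)) * G' t) (at t within {t0..})"
    by (rule DERIV_chain2[where f = "\<lambda>x::real. x powr (1/4)" and g = G and x = t, OF has_real_derivative_powr[OF G_pos[OF assms], of "1/4"]])
  moreover have "(1/4 * G t powr (1/4 - 1)) * G' t = r t ^ 3 * \<gamma> t"
  proof -
    have "r t ^ 3 * \<gamma> t = r t * (G' t / (4 * G t))"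
      by (simp only: r_sq_\<gamma>[OF assms, symmetric]) (simp add: power3_eq_cube power2_eq_square)
    moreover have "G t powr (1/4 - 1) = r t / G t"
      unfolding powr_diff using G_pos[OF assms] by (simp add: r_def)
    ultimately show ?thesis by simp
  qed
  ultimately show r: "(r has_real_derivative r t ^ 3 * \<gamma> t) (at t within {t0..})"
    by (simp add: r_def[abs_def])
  have "((\<lambda>t. inverse (r t)) has_real_derivative - (inverse (r t) * (r t ^ 3 * \<gamma> t) * inverse (r t))) (at t within {t0..})"
    using r r_pos[OF assms] by (intro DERIV_inverse') auto
  then show "((\<lambda>t. inverse (r t)) has_real_derivative - (r t * \<gamma> t)) (at t within {t0..})"
    using r_pos[OF assms] by (simp add: power3_eq_cube field_simps)
qed

lemma inverse_E_deriv:
  assumes "t \<ge> t0"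
  shows "((\<lambda>t. inverse (E t)) has_vector_derivative - (P t / 2) * inverse (E t)) (at t within {t0..})"
proof -
  have "((\<lambda>t. - integral {t0..t} P / 2) has_vector_derivative - P t / 2) (at t within {t0..})"
    using integral_has_vector_derivative_atLeast[OF continuous_coeffs(3) assms]
    by (intro has_vector_derivative_divide has_vector_derivative_minus)
  from field_vector_diff_chain_within[OF this DERIV_subset[OF DERIV_exp]]
  show ?thesis by (simp add: E_def[abs_def] exp_minus o_def mult.commute)
qed

section \<open>Bounds for a single solution\<close>

context
  fixes \<phi> \<psi> assumes sol: "is_solution t0 a b c d \<phi> \<psi>"
begin

text \<open>As \<open>v = r u\<close>, the derivative is \<open>r' u + r u'\<close> with
  \<open>r' = r^3 \<gamma>\<close> and \<open>u' = r w\<close>.\<close>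

lemma v_deriv:
  assumes t: "t \<ge> t0"
  shows "(v \<phi> has_vector_derivative (r t)\<^sup>2 *\<^sub>R (\<gamma> t *\<^sub>R v \<phi> t + w \<phi> \<psi> t)) (at t within {t0..})"
proof -
  have "(\<phi> has_vector_derivative a t * \<phi> t + b t * \<psi> t) (at t within {t0..})"
    using sol t by (simp add: is_solution_def)
  from has_vector_derivative_mult[OF has_vector_derivative_of_real[OF r_deriv(1)[OF t]]
      has_vector_derivative_mult[OF this inverse_E_deriv[OF t]]]
  show ?thesis
    unfolding v_def[abs_def] w_def
    apply (rule has_vector_derivative_eq_rhs)
    using r_pos[OF t] by (simp add: scaleR_conv_of_real field_simps power2_eq_square power3_eq_cube E_nz)
qed

text \<open>As \<open>w = u' / r\<close>, the derivative is \<open>u'' / r - r \<gamma> u'\<close>,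
  and \<open>u'' = - G u\<close> with \<open>G = r^4\<close>.\<close>

lemma w_deriv:
  assumes t: "t \<ge> t0"
  shows "(w \<phi> \<psi> has_vector_derivative - ((r t)\<^sup>2 *\<^sub>R (\<gamma> t *\<^sub>R w \<phi> \<psi> t + v \<phi> t))) (at t within {t0..})"
proof -
  let ?\<phi>' = "a t * \<phi> t + b t * \<psi> t" and ?\<psi>' = "c t * \<phi> t + d t * \<psi> t" and ?F = "at t within {t0..}"
  let ?y' = "(a t * ?\<phi>' + a' t * \<phi> t) + (b t * ?\<psi>' + b' t * \<psi> t) - (P t / 2 * ?\<phi>' + P' t / 2 * \<phi> t)"
  let ?y = "?\<phi>' - P t / 2 * \<phi> t"
  have \<phi>: "(\<phi> has_vector_derivative ?\<phi>') ?F" and \<psi>: "(\<psi> has_vector_derivative ?\<psi>') ?F"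
    using sol t by (simp_all add: is_solution_def)
  have y: "((\<lambda>t. a t * \<phi> t + b t * \<psi> t - P t / 2 * \<phi> t) has_vector_derivative ?y') ?F"
    by (intro has_vector_derivative_diff has_vector_derivative_add has_vector_derivative_mult
        has_vector_derivative_divide a b P \<phi> \<psi> t)
  \<comment> \<open>\<open>?y\<close> is \<open>E u'\<close>, so the left-hand side is
    \<open>E u''\<close>: this is \<open>u'' + G u = 0\<close> multiplied by
    \<open>E\<close>.\<close>
  have key: "?y' - P t / 2 * ?y = - of_real (G t) * \<phi> t"
  proof -
    \<comment> \<open>Writing \<open>b' = q b\<close> removes the division by \<open>b\<close> and
      leaves a polynomial identity.\<close>
    define q where "q = b' t / b t"
    have b': "b' t = q * b t" and P_q: "P t = a t + d t + q"
      using P_eq[OF t] b_nz[OF t] by (simp_all add: q_def)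
    have "(a t * b' t - a' t * b t) / b t = a t * q - a' t"
      using b_nz[OF t] by (simp add: b' field_simps)
    then have G_q: "of_real (G t) = a t * q - a' t + a t * d t - b t * c t + 1/2 * P' t - 1/4 * (P t)\<^sup>2"
      using G_eq[OF t] by simp
    show ?thesis
      by (simp add: G_q P_q b' power2_eq_square field_simps)
  qed
  have "(w \<phi> \<psi> has_vector_derivative of_real (inverse (r t)) * (?y * (- (P t / 2) * inverse (E t)) + ?y' * inverse (E t))
      + of_real (- (r t * \<gamma> t)) * (?y * inverse (E t))) ?F"
    unfolding w_def[abs_def]
    by (intro has_vector_derivative_mult has_vector_derivative_of_real r_deriv(2)[OF t] inverse_E_deriv[OF t] y)
  moreover have "?y * (- (P t / 2) * inverse (E t)) + ?y' * inverse (E t) = (?y' - P t / 2 * ?y) * inverse (E t)"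
    by (simp add: algebra_simps)
  ultimately have "(w \<phi> \<psi> has_vector_derivative of_real (inverse (r t)) * (- of_real (r t ^ 4) * \<phi> t * inverse (E t))
      + of_real (- (r t * \<gamma> t)) * (?y * inverse (E t))) ?F"
    by (simp only: key r_fourth[OF t])
  then show ?thesis
    apply (rule has_vector_derivative_eq_rhs)
    using r_pos[OF t]
    by (simp add: w_def v_def scaleR_conv_of_real field_simps power2_eq_square power4_eq_xxxx E_nz)
qed

lemma vw_cont: "continuous_on {t0..} (v \<phi>)" "continuous_on {t0..} (w \<phi> \<psi>)"
  using v_deriv w_deriv by (auto intro!: continuous_on_vector_derivative)

text \<open>\<open>oscillator_bounded\<close> with \<open>g = r^2\<close> controls the tail on which
  \<open>\<gamma>\<close> stays away from 1 in modulus; continuity controls the compact initial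
  piece.\<close>

lemma vw_bounded: "\<exists>C. \<forall>t\<ge>t0. cmod (v \<phi> t) \<le> C \<and> cmod (w \<phi> \<psi> t) \<le> C"
proof -
  \<comment> \<open>The midpoint between 1 and the limit of the modulus of \<open>\<gamma>\<close>,
    which is less than 1 because \<open>\<bar>\<alpha>\<bar> < 4\<close>.\<close>
  define \<rho> where "\<rho> = (\<bar>\<alpha>\<bar> / 4 + 1) / 2"
  have \<rho>: "\<bar>\<alpha> / 4\<bar> < \<rho>" "\<rho> < 1" using \<alpha> by (auto simp: \<rho>_def)
  have "(\<gamma> \<longlongrightarrow> \<alpha> / 4) at_top" unfolding \<gamma>_def[abs_def] by (intro tendsto_intros lim) auto
  then have "((\<lambda>t. \<bar>\<gamma> t\<bar>) \<longlongrightarrow> \<bar>\<alpha> / 4\<bar>) at_top" by (rule tendsto_rabs)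
  then have "\<forall>\<^sub>F t in at_top. \<bar>\<gamma> t\<bar> < \<rho>" using \<rho>(1) by (rule order_tendstoD)
  then obtain T1 where T1: "\<And>t. t \<ge> T1 \<Longrightarrow> \<bar>\<gamma> t\<bar> < \<rho>" by (auto simp: eventually_at_top_linorder)
  define T where "T = max t0 T1"
  have T: "t0 \<le> T" "T1 \<le> T" "{T..} \<subseteq> {t0..}" by (auto simp: T_def)
  obtain M where M: "\<And>t. t \<ge> t0 \<Longrightarrow> total_var t0 t (\<lambda>s. G' s / G s powr (3/2)) \<le> ereal M"
    using var by blast
  have "\<exists>C. \<forall>t\<ge>T. (norm (v \<phi> t))\<^sup>2 + (norm (w \<phi> \<psi> t))\<^sup>2 \<le> C"
  proof (rule oscillator_bounded)
    show "(v \<phi> has_vector_derivative (r t)\<^sup>2 *\<^sub>R (\<gamma> t *\<^sub>R v \<phi> t + w \<phi> \<psi> t)) (at t within {T..})" if "t \<ge> T" for t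
      using that T by (intro has_vector_derivative_within_subset[OF v_deriv]) auto
    show "(w \<phi> \<psi> has_vector_derivative - ((r t)\<^sup>2 *\<^sub>R (\<gamma> t *\<^sub>R w \<phi> \<psi> t + v \<phi> t))) (at t within {T..})" if "t \<ge> T" for t
      using that T by (intro has_vector_derivative_within_subset[OF w_deriv]) auto
    show "continuous_on {T..} \<gamma>" "continuous_on {T..} (\<lambda>t. (r t)\<^sup>2)"
      using T by (auto intro!: continuous_intros intro: continuous_on_subset[OF \<gamma>_cont] continuous_on_subset[OF r_cont])
    show "\<bar>\<gamma> t\<bar> \<le> \<rho>" if "t \<ge> T" for t using T1[of t] T that by simp
    show "\<rho> < 1" by fact
    \<comment> \<open>The factor 1/4 in \<open>\<gamma>\<close> turns \<open>M\<close> into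
      \<open>M / 4\<close>; partitions from \<open>T\<close> are compared with the variation counted
      from \<open>t0\<close>.\<close>
    show "(\<Sum>i<n. \<bar>\<gamma> (x (Suc i)) - \<gamma> (x i)\<bar>) \<le> M / 4" if x: "mono_on {..n} x" "x 0 = T" for n x
    proof -
      let ?f = "\<lambda>s. G' s / G s powr (3/2)"
      have "x 0 \<le> x n" using x(1) by (auto simp: mono_on_def)
      then have "ereal (\<Sum>i<n. \<bar>?f (x (Suc i)) - ?f (x i)\<bar>) \<le> ereal M"
        using sum_le_total_var[OF x T(1), of ?f] M[of "x n"] x(2) T(1) by (meson order_trans)
      moreover have "(\<Sum>i<n. \<bar>\<gamma> (x (Suc i)) - \<gamma> (x i)\<bar>) = (\<Sum>i<n. \<bar>?f (x (Suc i)) - ?f (x i)\<bar>) / 4"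
        unfolding sum_divide_distrib \<gamma>_def diff_divide_distrib[symmetric] abs_divide by simp
      ultimately show ?thesis by simp
    qed
  qed
  then obtain C where C: "\<And>t. t \<ge> T \<Longrightarrow> (norm (v \<phi> t))\<^sup>2 + (norm (w \<phi> \<psi> t))\<^sup>2 \<le> C" by blast
  have "bounded ((\<lambda>t. (norm (v \<phi> t))\<^sup>2 + (norm (w \<phi> \<psi> t))\<^sup>2) ` {t0..T})"
    by (intro compact_imp_bounded compact_continuous_image continuous_intros
        continuous_on_subset[OF vw_cont(1)] continuous_on_subset[OF vw_cont(2)]) auto
  then obtain B where B: "\<And>t. t \<in> {t0..T} \<Longrightarrow> (norm (v \<phi> t))\<^sup>2 + (norm (w \<phi> \<psi> t))\<^sup>2 \<le> B"
    unfolding bounded_iff by force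
  have "cmod (v \<phi> t) \<le> sqrt (max B C) \<and> cmod (w \<phi> \<psi> t) \<le> sqrt (max B C)" if "t \<ge> t0" for t
  proof -
    have "(norm (v \<phi> t))\<^sup>2 + (norm (w \<phi> \<psi> t))\<^sup>2 \<le> max B C"
      using B[of t] C[of t] that by (cases "t \<le> T") auto
    then have "(norm (v \<phi> t))\<^sup>2 \<le> max B C" "(norm (w \<phi> \<psi> t))\<^sup>2 \<le> max B C"
      using zero_le_power2[of "norm (v \<phi> t)"] zero_le_power2[of "norm (w \<phi> \<psi> t)"] by linarith+
    then show ?thesis by (simp add: real_le_rsqrt)
  qed
  then show ?thesis by blast
qed

lemma solution_eq:
  assumes t: "t \<ge> t0"
  shows "\<phi> t = E t / r t * v \<phi> t"
    and "a t * \<phi> t + b t * \<psi> t = E t * r t * w \<phi> \<psi> t + E t * P t / (2 * r t) * v \<phi> t"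
  using r_pos[OF t] by (simp_all add: v_def w_def E_nz field_simps)

text \<open>Since \<open>v\<close> and \<open>w\<close> are bounded, \<open>\<phi>\<close> and
  \<open>\<phi>'\<close> are controlled by their amplitudes. Then
  \<open>\<psi> = (\<phi>' - a \<phi>) / b\<close> is controlled through the bounds on
  \<open>a\<close> and \<open>1 / b\<close>.\<close>

lemma solution_le: "\<exists>C. \<forall>t\<ge>t0. cmod (\<phi> t) + cmod (\<psi> t) \<le> C * (X t + Y t)"
proof -
  obtain C where C: "\<And>t. t \<ge> t0 \<Longrightarrow> cmod (v \<phi> t) \<le> C" "\<And>t. t \<ge> t0 \<Longrightarrow> cmod (w \<phi> \<psi> t) \<le> C"
    using vw_bounded by blast
  have C0: "0 \<le> C" using C(1)[of t0] by (smt (verit) norm_ge_zero)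
  obtain A where A: "A > 0" "\<And>t. t \<ge> t0 \<Longrightarrow> cmod (a t) \<le> A"
    using a_bdd by (auto simp: bounded_pos)
  obtain B where B: "B > 0" "\<And>t. t \<ge> t0 \<Longrightarrow> cmod (1 / b t) \<le> B"
    using b_inv_bdd by (auto simp: bounded_pos)
  have "cmod (\<phi> t) + cmod (\<psi> t) \<le> (C + B * (C + A * C)) * (X t + Y t)" if t: "t \<ge> t0" for t
  proof -
    let ?y = "a t * \<phi> t + b t * \<psi> t"
    have XY: "cmod (E t) / r t \<le> X t" "cmod (E t) * cmod (P t) / (2 * r t) \<le> X t" "0 \<le> X t" "0 \<le> Y t"
      using r_pos[OF t] by (auto simp: X_def Y_def field_simps)
    have "cmod (\<phi> t) = cmod (E t) / r t * cmod (v \<phi> t)"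
      by (subst solution_eq(1)[OF t]) (use r_pos[OF t] in \<open>simp add: norm_mult norm_divide\<close>)
    also have "\<dots> \<le> X t * C" using XY C[OF t] by (intro mult_mono) auto
    finally have \<phi>: "cmod (\<phi> t) \<le> C * X t" by (simp add: mult.commute)
    have "cmod ?y \<le> cmod (E t) * r t * cmod (w \<phi> \<psi> t) + cmod (E t) * cmod (P t) / (2 * r t) * cmod (v \<phi> t)"
      unfolding solution_eq(2)[OF t]
      by (rule order_trans[OF norm_triangle_ineq]) (use r_pos[OF t] in \<open>simp add: norm_mult norm_divide\<close>)
    also have "\<dots> \<le> Y t * C + X t * C"
      using XY C[OF t] by (intro add_mono mult_mono) (auto simp: Y_def)
    finally have y: "cmod ?y \<le> C * (X t + Y t)" by (simp add: algebra_simps)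
    have "\<psi> t = (1 / b t) * (?y - a t * \<phi> t)" using b_nz[OF t] by simp
    then have "cmod (\<psi> t) = cmod (1 / b t) * cmod (?y - a t * \<phi> t)" by (metis norm_mult)
    also have "\<dots> \<le> B * (C * (X t + Y t) + A * (C * (X t + Y t)))"
    proof (intro mult_mono B(2)[OF t])
      have "cmod (a t * \<phi> t) \<le> A * (C * (X t + Y t))"
      proof -
        have "C * X t \<le> C * (X t + Y t)" using XY C0 by (intro mult_left_mono) auto
        then show ?thesis unfolding norm_mult using A \<phi> A(2)[OF t] C0 XY by (intro mult_mono) auto
      qed
      then show "cmod (?y - a t * \<phi> t) \<le> C * (X t + Y t) + A * (C * (X t + Y t))"
        using y norm_triangle_ineq4[of ?y "a t * \<phi> t"] by linarith
    qed (use B in auto)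
    finally have "cmod (\<psi> t) \<le> B * (C + A * C) * (X t + Y t)" by (simp add: algebra_simps)
    moreover have "cmod (\<phi> t) \<le> C * (X t + Y t)"
      using \<phi> mult_nonneg_nonneg[OF C0 XY(4)] by (simp add: algebra_simps)
    ultimately show ?thesis by (simp add: algebra_simps)
  qed
  then show ?thesis by blast
qed

end

section \<open>The Wronskian and the estimate of the amplitudes by solutions\<close>

text \<open>The matrix of the system for \<open>v\<close> and \<open>w\<close> has trace
  \<open>r^2 \<gamma> - r^2 \<gamma> = 0\<close>, so the determinant is constant. At
  \<open>t0\<close> one has \<open>E = 1\<close> and the powers of \<open>r\<close> cancel.\<close>

lemma wronskian:
  assumes 1: "is_solution t0 a b c d \<phi>1 \<psi>1" and 2: "is_solution t0 a b c d \<phi>2 \<psi>2"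
    and init: "\<phi>1 t0 = 1" "\<psi>1 t0 = 0" "\<phi>2 t0 = 0" "\<psi>2 t0 = 1" and t: "t \<ge> t0"
  shows "v \<phi>1 t * w \<phi>2 \<psi>2 t - v \<phi>2 t * w \<phi>1 \<psi>1 t = b t0"
proof -
  let ?W = "\<lambda>t. v \<phi>1 t * w \<phi>2 \<psi>2 t - v \<phi>2 t * w \<phi>1 \<psi>1 t"
  have W0: "(?W has_vector_derivative 0) (at t within {t0..})" if "t \<ge> t0" for t
    by (rule has_vector_derivative_eq_rhs[OF has_vector_derivative_diff[OF
        has_vector_derivative_mult[OF v_deriv[OF 1 that] w_deriv[OF 2 that]]
        has_vector_derivative_mult[OF v_deriv[OF 2 that] w_deriv[OF 1 that]]]])
      (simp add: scaleR_conv_of_real algebra_simps)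
  obtain k where k: "\<And>t. t \<in> {t0..} \<Longrightarrow> ?W t = k"
    by (rule has_vector_derivative_zero_constant[of "{t0..}" ?W]) (use W0 in auto)
  have "?W t0 = b t0"
    using r_pos[of t0] by (simp add: v_def w_def init E_def)
  with k[of t] k[of t0] t show ?thesis by simp
qed

text \<open>This reverses \<open>solution_le\<close> by Cramer's rule: an amplitude times the
  Wronskian is a combination of \<open>\<phi>\<close> or \<open>\<phi>'\<close> of two solutions
  with bounded coefficients taken from \<open>v\<close> and \<open>w\<close>. The Wronskian is the
  nonzero constant \<open>b t0\<close>, so it can be divided out.\<close>

lemma solutions_ge:
  "\<exists>\<phi>1 \<psi>1 \<phi>2 \<psi>2 C. is_solution t0 a b c d \<phi>1 \<psi>1 \<and> is_solution t0 a b c d \<phi>2 \<psi>2 \<and>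
     (\<forall>t\<ge>t0. X t + Y t \<le> C * (cmod (\<phi>1 t) + cmod (\<psi>1 t) + (cmod (\<phi>2 t) + cmod (\<psi>2 t))))"
proof -
  note ex = linear_system_solution_exists[OF continuous_coeffs(1,2) c_cont d_cont]
  obtain \<phi>1 \<psi>1 where 1: "\<phi>1 t0 = 1" "\<psi>1 t0 = 0" "is_solution t0 a b c d \<phi>1 \<psi>1" using ex by blast
  obtain \<phi>2 \<psi>2 where 2: "\<phi>2 t0 = 0" "\<psi>2 t0 = 1" "is_solution t0 a b c d \<phi>2 \<psi>2" using ex by blast
  obtain C1 where C1: "\<And>t. t \<ge> t0 \<Longrightarrow> cmod (v \<phi>1 t) \<le> C1 \<and> cmod (w \<phi>1 \<psi>1 t) \<le> C1" using vw_bounded[OF 1(3)] by blast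
  obtain C2 where C2: "\<And>t. t \<ge> t0 \<Longrightarrow> cmod (v \<phi>2 t) \<le> C2 \<and> cmod (w \<phi>2 \<psi>2 t) \<le> C2" using vw_bounded[OF 2(3)] by blast
  define C where "C = max C1 C2"
  have C: "cmod (v \<phi>1 t) \<le> C" "cmod (w \<phi>1 \<psi>1 t) \<le> C" "cmod (v \<phi>2 t) \<le> C" "cmod (w \<phi>2 \<psi>2 t) \<le> C" if "t \<ge> t0" for t
    using C1[OF that] C2[OF that] by (auto simp: C_def)
  have C0: "0 \<le> C" using C(1)[of t0] by (smt (verit) norm_ge_zero)
  obtain A where A: "A > 0" "\<And>t. t \<ge> t0 \<Longrightarrow> cmod (a t) \<le> A" using a_bdd by (auto simp: bounded_pos)
  obtain B where B: "B > 0" "\<And>t. t \<ge> t0 \<Longrightarrow> cmod (b t) \<le> B" using b_bdd by (auto simp: bounded_pos)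
  define k where "k = cmod (b t0)"
  have k: "k > 0" using b_nz by (simp add: k_def)
  let ?S = "\<lambda>t. cmod (\<phi>1 t) + cmod (\<psi>1 t) + (cmod (\<phi>2 t) + cmod (\<psi>2 t))"
  have "X t + Y t \<le> (C + 3 * (C * (A + B))) / k * ?S t" if t: "t \<ge> t0" for t
  proof -
    define y1 y2 where "y1 = a t * \<phi>1 t + b t * \<psi>1 t" and "y2 = a t * \<phi>2 t + b t * \<psi>2 t"
    define W where "W = v \<phi>1 t * w \<phi>2 \<psi>2 t - v \<phi>2 t * w \<phi>1 \<psi>1 t"
    have W: "cmod W = k" unfolding W_def k_def wronskian[OF 1(3) 2(3) 1(1,2) 2(1,2) t] ..
    have diff: "cmod (x * p - y * q) \<le> C * (cmod x + cmod y)" if "cmod p \<le> C" "cmod q \<le> C" for x y p q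
    proof -
      have "cmod (x * p - y * q) \<le> cmod x * cmod p + cmod y * cmod q"
        using norm_triangle_ineq4[of "x * p" "y * q"] by (simp add: norm_mult)
      also have "\<dots> \<le> cmod x * C + cmod y * C" using that by (intro add_mono mult_left_mono) auto
      finally show ?thesis by (simp add: algebra_simps)
    qed
    have y: "cmod y1 + cmod y2 \<le> (A + B) * ?S t"
    proof -
      have *: "cmod (a t * x + b t * y) \<le> (A + B) * (cmod x + cmod y)" for x y
      proof -
        have "cmod (a t * x + b t * y) \<le> cmod (a t) * cmod x + cmod (b t) * cmod y"
          by (metis norm_triangle_ineq norm_mult)
        also have "\<dots> \<le> A * cmod x + B * cmod y"
          using A B t by (intro add_mono mult_right_mono) auto
        also have "\<dots> \<le> (A + B) * (cmod x + cmod y)" using A B by (simp add: algebra_simps)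
        finally show ?thesis .
      qed
      from *[of "\<phi>1 t" "\<psi>1 t"] *[of "\<phi>2 t" "\<psi>2 t"] show ?thesis
        unfolding y1_def y2_def distrib_left by linarith
    qed
    note s1 = solution_eq[OF 1(3) t, folded y1_def] and s2 = solution_eq[OF 2(3) t, folded y2_def]
    \<comment> \<open>Eliminating \<open>v\<close> or \<open>w\<close> between the two solutions
      isolates the amplitudes \<open>E / r\<close>, \<open>E r\<close> and
      \<open>E P / (2 r)\<close> in turn.\<close>
    have "E t / r t * W = \<phi>1 t * w \<phi>2 \<psi>2 t - \<phi>2 t * w \<phi>1 \<psi>1 t"
      unfolding s1(1) s2(1) W_def by (simp add: algebra_simps)
    then have "cmod (E t / r t * W) \<le> C * (cmod (\<phi>1 t) + cmod (\<phi>2 t))"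
      using diff[of "w \<phi>2 \<psi>2 t" "w \<phi>1 \<psi>1 t" "\<phi>1 t" "\<phi>2 t"] C[OF t] by simp
    then have e1: "cmod (E t) / r t * k \<le> C * (cmod (\<phi>1 t) + cmod (\<phi>2 t))"
      using r_pos[OF t] W by (simp add: norm_mult norm_divide)
    have "E t * r t * W = y2 * v \<phi>1 t - y1 * v \<phi>2 t"
      unfolding s1 s2 W_def by (simp add: algebra_simps)
    then have "cmod (E t * r t * W) \<le> C * (cmod y1 + cmod y2)"
      using diff[of "v \<phi>1 t" "v \<phi>2 t" y2 y1] C[OF t] by (simp add: add.commute)
    then have e2: "cmod (E t) * r t * k \<le> C * (cmod y1 + cmod y2)"
      using r_pos[OF t] W by (simp add: norm_mult)
    have "E t * P t / (2 * r t) * W = y1 * w \<phi>2 \<psi>2 t - y2 * w \<phi>1 \<psi>1 t"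
      unfolding s1 s2 W_def by (simp add: algebra_simps)
    then have "cmod (E t * P t / (2 * r t) * W) \<le> C * (cmod y1 + cmod y2)"
      using diff[of "w \<phi>2 \<psi>2 t" "w \<phi>1 \<psi>1 t" y1 y2] C[OF t] by simp
    then have e3: "cmod (E t) * cmod (P t) / (2 * r t) * k \<le> C * (cmod y1 + cmod y2)"
      using r_pos[OF t] W by (simp add: norm_mult norm_divide)
    \<comment> \<open>The later coefficient 3 counts \<open>e2\<close> once and \<open>e3\<close>
      twice, since \<open>X\<close> contains \<open>P / r\<close> and not
      \<open>P / (2 r)\<close>.\<close>
    have "(X t + Y t) * k = cmod (E t) / r t * k + 2 * (cmod (E t) * cmod (P t) / (2 * r t) * k) + cmod (E t) * r t * k"
      using r_pos[OF t] by (simp add: X_def Y_def field_simps)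
    also have "\<dots> \<le> C * (cmod (\<phi>1 t) + cmod (\<phi>2 t)) + 3 * (C * (cmod y1 + cmod y2))"
      using e1 e2 e3 by linarith
    also have "\<dots> \<le> C * ?S t + 3 * (C * ((A + B) * ?S t))"
      using C0 y by (intro add_mono mult_left_mono) auto
    finally show ?thesis using k by (simp add: field_simps)
  qed
  with 1(3) 2(3) show ?thesis by blast
qed

lemma XY_pos: "t \<ge> t0 \<Longrightarrow> X t > 0" "t \<ge> t0 \<Longrightarrow> Y t > 0"
  using r_pos[of t] by (auto simp: X_def Y_def E_nz add_pos_nonneg)

section \<open>Stability as boundedness or decay of the amplitudes\<close>

text \<open>In one direction two solutions suffice, by \<open>solutions_ge\<close>, and positivity
  separates \<open>X\<close> from \<open>Y\<close>; in the other, \<open>solution_le\<close> covers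
  every solution.\<close>

lemma lyapunov_stable_iff:
  "lyapunov_stable t0 a b c d \<longleftrightarrow> (\<exists>C. \<forall>t\<in>{t0..}. X t \<le> C) \<and> (\<exists>C. \<forall>t\<in>{t0..}. Y t \<le> C)"
proof
  assume st: "lyapunov_stable t0 a b c d"
  obtain \<phi>1 \<psi>1 \<phi>2 \<psi>2 C where s: "is_solution t0 a b c d \<phi>1 \<psi>1" "is_solution t0 a b c d \<phi>2 \<psi>2"
    and C: "\<And>t. t \<ge> t0 \<Longrightarrow> X t + Y t \<le> C * (cmod (\<phi>1 t) + cmod (\<psi>1 t) + (cmod (\<phi>2 t) + cmod (\<psi>2 t)))"
    using solutions_ge by blast
  have "\<exists>K. \<forall>t\<ge>t0. cmod (\<phi>1 t) \<le> K" "\<exists>K. \<forall>t\<ge>t0. cmod (\<psi>1 t) \<le> K"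
    "\<exists>K. \<forall>t\<ge>t0. cmod (\<phi>2 t) \<le> K" "\<exists>K. \<forall>t\<ge>t0. cmod (\<psi>2 t) \<le> K"
    using st s unfolding lyapunov_stable_def bounded_iff by (metis atLeast_iff imageI)+
  then obtain K1 K2 K3 K4 where K: "\<And>t. t \<ge> t0 \<Longrightarrow> cmod (\<phi>1 t) \<le> K1" "\<And>t. t \<ge> t0 \<Longrightarrow> cmod (\<psi>1 t) \<le> K2"
    "\<And>t. t \<ge> t0 \<Longrightarrow> cmod (\<phi>2 t) \<le> K3" "\<And>t. t \<ge> t0 \<Longrightarrow> cmod (\<psi>2 t) \<le> K4"
    by blast
  \<comment> \<open>\<open>C\<close> comes without a sign, so its modulus is used for
    monotonicity.\<close>
  have XY: "X t + Y t \<le> \<bar>C\<bar> * (K1 + K2 + (K3 + K4))" if "t \<ge> t0" for t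
    by (rule order_trans[OF C[OF that]], rule mult_mono) (use K[OF that] in \<open>auto intro!: add_mono\<close>)
  have "X t \<le> \<bar>C\<bar> * (K1 + K2 + (K3 + K4))" "Y t \<le> \<bar>C\<bar> * (K1 + K2 + (K3 + K4))" if "t \<ge> t0" for t
    using XY[OF that] XY_pos[OF that] by linarith+
  then show "(\<exists>C. \<forall>t\<in>{t0..}. X t \<le> C) \<and> (\<exists>C. \<forall>t\<in>{t0..}. Y t \<le> C)" by (meson atLeast_iff)
next
  assume "(\<exists>C. \<forall>t\<in>{t0..}. X t \<le> C) \<and> (\<exists>C. \<forall>t\<in>{t0..}. Y t \<le> C)"
  then obtain K1 K2 where K: "\<And>t. t \<ge> t0 \<Longrightarrow> X t \<le> K1" "\<And>t. t \<ge> t0 \<Longrightarrow> Y t \<le> K2" by auto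
  show "lyapunov_stable t0 a b c d"
    unfolding lyapunov_stable_def
  proof (intro allI impI)
    fix \<phi> \<psi> assume "is_solution t0 a b c d \<phi> \<psi>"
    then obtain C where C: "\<And>t. t \<ge> t0 \<Longrightarrow> cmod (\<phi> t) + cmod (\<psi> t) \<le> C * (X t + Y t)"
      using solution_le by blast
    have le: "cmod (\<phi> t) + cmod (\<psi> t) \<le> \<bar>C\<bar> * (K1 + K2)" if "t \<ge> t0" for t
      by (rule order_trans[OF C[OF that]], rule mult_mono)
        (use K[OF that] XY_pos[OF that] in \<open>auto intro!: add_mono add_nonneg_nonneg less_imp_le\<close>)
    have "cmod (\<phi> t) \<le> \<bar>C\<bar> * (K1 + K2)" "cmod (\<psi> t) \<le> \<bar>C\<bar> * (K1 + K2)" if "t \<ge> t0" for t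
      using le[OF that] norm_ge_zero[of "\<phi> t"] norm_ge_zero[of "\<psi> t"] by linarith+
    then show "bounded (\<phi> ` {t0..}) \<and> bounded (\<psi> ` {t0..})"
      by (auto intro!: boundedI[where B = "\<bar>C\<bar> * (K1 + K2)"])
  qed
qed

text \<open>The same two estimates, now used as null majorants.\<close>

lemma asymptotically_stable_iff:
  "asymptotically_stable t0 a b c d \<longleftrightarrow> (X \<longlongrightarrow> 0) at_top \<and> (Y \<longlongrightarrow> 0) at_top"
proof
  assume st: "asymptotically_stable t0 a b c d"
  obtain \<phi>1 \<psi>1 \<phi>2 \<psi>2 C where s: "is_solution t0 a b c d \<phi>1 \<psi>1" "is_solution t0 a b c d \<phi>2 \<psi>2"
    and C: "\<And>t. t \<ge> t0 \<Longrightarrow> X t + Y t \<le> C * (cmod (\<phi>1 t) + cmod (\<psi>1 t) + (cmod (\<phi>2 t) + cmod (\<psi>2 t)))"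
    using solutions_ge by blast
  have lim0: "((\<lambda>t. C * (cmod (\<phi>1 t) + cmod (\<psi>1 t) + (cmod (\<phi>2 t) + cmod (\<psi>2 t)))) \<longlongrightarrow> 0) at_top"
    using st s unfolding asymptotically_stable_def
    by (intro tendsto_mult_right_zero tendsto_add_zero tendsto_norm_zero) blast+
  have ev: "\<forall>\<^sub>F t in at_top. norm (X t) \<le> C * (cmod (\<phi>1 t) + cmod (\<psi>1 t) + (cmod (\<phi>2 t) + cmod (\<psi>2 t)))"
    "\<forall>\<^sub>F t in at_top. norm (Y t) \<le> C * (cmod (\<phi>1 t) + cmod (\<psi>1 t) + (cmod (\<phi>2 t) + cmod (\<psi>2 t)))"
    using eventually_ge_at_top[of t0] by (eventually_elim, use C XY_pos in fastforce)+
  show "(X \<longlongrightarrow> 0) at_top \<and> (Y \<longlongrightarrow> 0) at_top"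
    using Lim_null_comparison[OF ev(1) lim0] Lim_null_comparison[OF ev(2) lim0] by blast
next
  assume XY: "(X \<longlongrightarrow> 0) at_top \<and> (Y \<longlongrightarrow> 0) at_top"
  show "asymptotically_stable t0 a b c d"
    unfolding asymptotically_stable_def
  proof (intro allI impI)
    fix \<phi> \<psi> assume "is_solution t0 a b c d \<phi> \<psi>"
    then obtain C where C: "\<And>t. t \<ge> t0 \<Longrightarrow> cmod (\<phi> t) + cmod (\<psi> t) \<le> C * (X t + Y t)"
      using solution_le by blast
    have lim0: "((\<lambda>t. C * (X t + Y t)) \<longlongrightarrow> 0) at_top"
      using XY by (intro tendsto_mult_right_zero tendsto_add_zero) blast+
    have ev: "\<forall>\<^sub>F t in at_top. norm (\<phi> t) \<le> C * (X t + Y t)" "\<forall>\<^sub>F t in at_top. norm (\<psi> t) \<le> C * (X t + Y t)"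
      using eventually_ge_at_top[of t0]
      by (eventually_elim, use C in \<open>smt (verit) norm_ge_zero\<close>)+
    show "(\<phi> \<longlongrightarrow> 0) at_top \<and> (\<psi> \<longlongrightarrow> 0) at_top"
      using Lim_null_comparison[OF ev(1) lim0] Lim_null_comparison[OF ev(2) lim0] by blast
  qed
qed

section \<open>From the amplitudes to the expressions of the criterion\<close>

text \<open>The squared modulus of \<open>E\<close> is the exponential of the real part of the
  integral of \<open>P\<close>. There \<open>P\<close> exceeds \<open>a + d\<close> by b'/b, whose
  integral has real part \<open>ln (cmod (b t)) - ln (cmod (b t0))\<close>.\<close>

lemma ln_norm_E:
  assumes t: "t \<ge> t0"
  shows "2 * ln (cmod (E t)) + ln (cmod (b t0)) = integral {t0..t} (\<lambda>\<tau>. Re (a \<tau> + d \<tau>)) + ln (cmod (b t))"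
proof -
  \<comment> \<open>\<open>J\<close> integrates b'/b and replaces a complex logarithm of
    \<open>b\<close>: no branch has to be chosen, because \<open>exp (- J s) * b s\<close> has
    derivative zero.\<close>
  define J where "J s = integral {t0..s} (\<lambda>\<tau>. P \<tau> - (a \<tau> + d \<tau>))" for s
  have cont: "continuous_on {t0..} (\<lambda>\<tau>. P \<tau> - (a \<tau> + d \<tau>))" "continuous_on {t0..} (\<lambda>\<tau>. a \<tau> + d \<tau>)"
    by (intro continuous_intros continuous_coeffs d_cont)+
  have J0: "((\<lambda>s. exp (- J s) * b s) has_vector_derivative 0) (at s within {t0..})" if s: "s \<ge> t0" for s
  proof -
    have "((\<lambda>s. - J s) has_vector_derivative - (P s - (a s + d s))) (at s within {t0..})"
      unfolding J_def[abs_def] by (intro has_vector_derivative_minus integral_has_vector_derivative_atLeast cont s)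
    from field_vector_diff_chain_within[OF this DERIV_subset[OF DERIV_exp]]
    have "((\<lambda>s. exp (- J s)) has_vector_derivative - (P s - (a s + d s)) * exp (- J s)) (at s within {t0..})"
      by (simp add: o_def)
    from has_vector_derivative_mult[OF this b[OF s]] show ?thesis
      using P_eq[OF s] b_nz[OF s] by (simp add: field_simps)
  qed
  obtain k where k: "\<And>s. s \<in> {t0..} \<Longrightarrow> exp (- J s) * b s = k"
    by (rule has_vector_derivative_zero_constant[of "{t0..}" "\<lambda>s. exp (- J s) * b s"]) (use J0 in auto)
  have "exp (- J t) * b t = b t0" using k[of t] k[of t0] t by (simp add: J_def)
  then have "ln (cmod (exp (- J t) * b t)) = ln (cmod (b t0))" by simp
  then have J: "ln (cmod (b t0)) = ln (cmod (b t)) - Re (J t)"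
    using b_nz[OF t] by (simp add: norm_mult ln_mult)
  have int: "f integrable_on {t0..t}" if "continuous_on {t0..} f" for f :: "real \<Rightarrow> complex"
    by (rule integrable_continuous_real, rule continuous_on_subset[OF that]) auto
  have "integral {t0..t} P = J t + integral {t0..t} (\<lambda>\<tau>. a \<tau> + d \<tau>)"
    unfolding J_def using integral_add[OF int[OF cont(1)] int[OF cont(2)]] by simp
  moreover have "Re (integral {t0..t} (\<lambda>\<tau>. a \<tau> + d \<tau>)) = integral {t0..t} (\<lambda>\<tau>. Re (a \<tau> + d \<tau>))"
    using has_integral_Re[OF integrable_integral[OF int[OF cont(2)]]] by (simp add: integral_unique)
  moreover have "2 * ln (cmod (E t)) = Re (integral {t0..t} P)" by (simp add: E_def)
  ultimately show ?thesis using J by simp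
qed

text \<open>Doubling \<open>ln (X t)\<close> turns the fourth root of \<open>G\<close> in the
  denominator into \<open>- 1/2 * ln (G t)\<close>.\<close>

lemma ln_X:
  assumes t: "t \<ge> t0"
  shows "integral {t0..t} (\<lambda>\<tau>. Re (a \<tau> + d \<tau>)) + ln (cmod (b t)) - 1/2 * ln (G t) + 2 * ln (1 + cmod (P t))
    = 2 * ln (X t) + ln (cmod (b t0))"
proof -
  have "0 < 1 + cmod (P t)" by (rule add_pos_nonneg) auto
  then have "ln (X t) = ln (cmod (E t)) + ln (1 + cmod (P t)) - ln (G t) / 4"
    using G_pos[OF t] r_pos[OF t] by (simp add: X_def ln_div ln_mult E_nz r_def ln_powr)
  then show ?thesis using ln_norm_E[OF t] by simp
qed

lemma ln_Y:
  assumes t: "t \<ge> t0"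
  shows "integral {t0..t} (\<lambda>\<tau>. Re (a \<tau> + d \<tau>)) + ln (cmod (b t)) + 1/2 * ln (G t) = 2 * ln (Y t) + ln (cmod (b t0))"
proof -
  have "ln (Y t) = ln (cmod (E t)) + ln (G t) / 4"
    using G_pos[OF t] r_pos[OF t] by (simp add: Y_def ln_mult E_nz r_def ln_powr)
  then show ?thesis using ln_norm_E[OF t] by simp
qed

theorem stability_criteria:
  defines "A \<equiv> \<lambda>t. integral {t0..t} (\<lambda>\<tau>. Re (a \<tau> + d \<tau>)) + ln (cmod (b t)) - 1/2 * ln (G t) + 2 * ln (1 + cmod (P t))"
    and "B \<equiv> \<lambda>t. integral {t0..t} (\<lambda>\<tau>. Re (a \<tau> + d \<tau>)) + ln (cmod (b t)) + 1/2 * ln (G t)"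
  shows "(lyapunov_stable t0 a b c d \<longleftrightarrow> (SUP t\<in>{t0..}. ereal (A t)) < \<infinity> \<and> (SUP t\<in>{t0..}. ereal (B t)) < \<infinity>) \<and>
    (asymptotically_stable t0 a b c d \<longleftrightarrow> filterlim A at_bot at_top \<and> filterlim B at_bot at_top)"
proof -
  \<comment> \<open>This additive constant affects neither finiteness of a supremum nor divergence
    to minus infinity.\<close>
  let ?k = "ln (cmod (b t0))"
  have A: "A t = 2 * ln (X t) + ?k" and B: "B t = 2 * ln (Y t) + ?k" if "t \<ge> t0" for t
    using ln_X[OF that] ln_Y[OF that] by (simp_all add: A_def B_def)
  have SUP: "(SUP t\<in>{t0..}. ereal (A t)) = (SUP t\<in>{t0..}. ereal (2 * ln (X t) + ?k))"
    "(SUP t\<in>{t0..}. ereal (B t)) = (SUP t\<in>{t0..}. ereal (2 * ln (Y t) + ?k))"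
    by (auto intro!: SUP_cong simp: A B)
  have ev: "\<forall>\<^sub>F t in at_top. A t = 2 * ln (X t) + ?k" "\<forall>\<^sub>F t in at_top. B t = 2 * ln (Y t) + ?k"
    "\<forall>\<^sub>F t in at_top. X t > 0" "\<forall>\<^sub>F t in at_top. Y t > 0"
    by (auto intro!: eventually_at_top_linorderI[of t0] simp: A B XY_pos)
  have "(SUP t\<in>{t0..}. ereal (A t)) < \<infinity> \<longleftrightarrow> (\<exists>C. \<forall>t\<in>{t0..}. X t \<le> C)"
    "(SUP t\<in>{t0..}. ereal (B t)) < \<infinity> \<longleftrightarrow> (\<exists>C. \<forall>t\<in>{t0..}. Y t \<le> C)"
    unfolding SUP by (rule SUP_ln_less_infinity_iff; simp add: XY_pos)+
  moreover have "filterlim A at_bot at_top \<longleftrightarrow> (X \<longlongrightarrow> 0) at_top" "filterlim B at_bot at_top \<longleftrightarrow> (Y \<longlongrightarrow> 0) at_top"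
    using filterlim_ln_at_bot_iff[OF ev(3)] filterlim_ln_at_bot_iff[OF ev(4)]
      filterlim_cong[OF refl refl ev(1)] filterlim_cong[OF refl refl ev(2)] by auto
  ultimately show ?thesis
    unfolding lyapunov_stable_iff asymptotically_stable_iff by simp
qed

end

section \<open>Instantiation with the original data\<close>

lemma C1_from_has_vector_derivative:
  assumes "C1_from t0 f" and "t \<ge> t0"
  shows "(f has_vector_derivative hderiv t0 f t) (at t within {t0..})"
  using assms by (simp add: C1_from_def hderiv_def vector_derivative_works)

text \<open>Every point of the half-line, its endpoint included, is a limit point of it, so the
  derivative within it is determined.\<close>

lemma hderiv_unique:
  assumes "(f has_vector_derivative f') (at t within {t0..})" and "t \<ge> t0"
  shows "hderiv t0 f t = f'"
  unfolding hderiv_def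
proof (rule vector_derivative_within[OF _ assms(1)])
  show "at t within {t0..} \<noteq> bot"
    unfolding trivial_limit_within
    using islimpt_subset[OF islimpt_greaterThanLessThan1[of t "t + 1"], of "{t0..}"] assms(2) by fastforce
qed

theorem theorem3p4:
  fixes t0 \<alpha>1 :: real and a b c d :: "real \<Rightarrow> complex"
  assumes "C1_from t0 a" and "C1_from t0 b" and "C1_from t0 c" and "C1_from t0 d"
    and "\<And>t. t \<ge> t0 \<Longrightarrow> b t \<noteq> 0" and "\<And>t. t \<ge> t0 \<Longrightarrow> c t \<noteq> 0"
    and "C1_from t0 (S_plus_log t0 a d b)" and "C1_from t0 (S_plus_log t0 a d c)"
    and "C1_from t0 (G1 t0 a b c d)"
    and "bounded (a ` {t0..})" and "bounded (b ` {t0..})" and "bounded ((\<lambda>t. 1 / b t) ` {t0..})"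
    and "\<And>t. t \<ge> t0 \<Longrightarrow> G1 t0 a b c d t \<in> \<real> \<and> G1r t0 a b c d t > 0"
    and "((\<lambda>t. hderiv t0 (G1r t0 a b c d) t / G1r t0 a b c d t powr (3/2)) \<longlongrightarrow> \<alpha>1) at_top"
    and "\<bar>\<alpha>1\<bar> < 4"
    and "bounded (L1 t0 a b c d ` {t0..})"
    and "\<exists>M::real. \<forall>t\<ge>t0.
           total_var t0 t (\<lambda>s. hderiv t0 (G1r t0 a b c d) s / G1r t0 a b c d s powr (3/2)) \<le> ereal M"
  shows "(lyapunov_stable t0 a b c d \<longleftrightarrow>
            (SUP t\<in>{t0..}. ereal (integral {t0..t} (\<lambda>\<tau>. Re (S_fun a d \<tau>)) + ln (cmod (b t))
               - 1/2 * ln (G1r t0 a b c d t) + 2 * ln (1 + cmod (S_plus_log t0 a d b t)))) < \<infinity> \<and>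
            (SUP t\<in>{t0..}. ereal (integral {t0..t} (\<lambda>\<tau>. Re (S_fun a d \<tau>)) + ln (cmod (b t))
               + 1/2 * ln (G1r t0 a b c d t))) < \<infinity>)
       \<and> (asymptotically_stable t0 a b c d \<longleftrightarrow>
            filterlim (\<lambda>t. integral {t0..t} (\<lambda>\<tau>. Re (S_fun a d \<tau>)) + ln (cmod (b t))
               - 1/2 * ln (G1r t0 a b c d t) + 2 * ln (1 + cmod (S_plus_log t0 a d b t))) at_bot at_top \<and>
            filterlim (\<lambda>t. integral {t0..t} (\<lambda>\<tau>. Re (S_fun a d \<tau>)) + ln (cmod (b t))
               + 1/2 * ln (G1r t0 a b c d t)) at_bot at_top)"
proof -
  \<comment> \<open>Taking real parts transfers differentiability, and later continuity of the
    derivative, from the complex \<open>G1\<close> to \<open>G1r\<close>.\<close>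
  have G: "(G1r t0 a b c d has_vector_derivative Re (hderiv t0 (G1 t0 a b c d) t)) (at t within {t0..})"
    if "t \<ge> t0" for t
    unfolding G1r_def[abs_def]
    by (rule bounded_linear.has_vector_derivative[OF bounded_linear_Re C1_from_has_vector_derivative[OF assms(9) that]])
  interpret reduced_system t0 \<alpha>1 a b c d "hderiv t0 a" "hderiv t0 b" "S_plus_log t0 a d b"
    "hderiv t0 (S_plus_log t0 a d b)" "G1r t0 a b c d" "hderiv t0 (G1r t0 a b c d)"
  proof
    show "(G1r t0 a b c d has_vector_derivative hderiv t0 (G1r t0 a b c d) t) (at t within {t0..})" if "t \<ge> t0" for t
      using G[OF that] hderiv_unique[OF G[OF that] that] by simp
    have "continuous_on {t0..} f" if "C1_from t0 f" for f :: "real \<Rightarrow> complex"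
      using C1_from_has_vector_derivative[OF that] by (auto intro!: continuous_on_vector_derivative)
    then show "continuous_on {t0..} c" "continuous_on {t0..} d" using assms(3,4) by blast+
    have "continuous_on {t0..} (\<lambda>t. Re (hderiv t0 (G1 t0 a b c d) t))"
      using assms(9) by (auto simp: C1_from_def intro: continuous_intros)
    then show "continuous_on {t0..} (hderiv t0 (G1r t0 a b c d))"
      by (rule continuous_on_eq) (use hderiv_unique[OF G] in simp)
    show "complex_of_real (G1r t0 a b c d t) =
      (a t * hderiv t0 b t - hderiv t0 a t * b t) / b t + a t * d t - b t * c t +
         1/2 * hderiv t0 (S_plus_log t0 a d b) t - 1/4 * (S_plus_log t0 a d b t)\<^sup>2" if "t \<ge> t0" for t
    proof -
      \<comment> \<open>\<open>G1\<close> takes real values on the half-line, so passing to the real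
        part loses nothing.\<close>
      have "complex_of_real (G1r t0 a b c d t) = G1 t0 a b c d t"
        using assms(13)[OF that] by (simp add: G1r_def)
      then show ?thesis by (simp only: G1_def D1_def)
    qed
    show "S_plus_log t0 a d b t = a t + d t + hderiv t0 b t / b t" for t
      by (simp add: S_plus_log_def S_fun_def)
  qed (use assms C1_from_has_vector_derivative in auto)
  show ?thesis
    using stability_criteria by (simp only: S_fun_def)
qed

end
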